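(* Suppose $1\le r\le d_1/2$ and $N_{ij}\overset{\text{i.i.d.}}{\sim}\mathcal N(0,\sigma^2)$, and each $(i,j)$ lies in $\Omega$ independently with probability $p$. For $\sigma_r^\star>0$ let $\mathcal M^\star:=\{B\in\mathbb R^{d_1\times d_2}:\ \mathrm{rank}(B)=r,\ \sigma_r(B)\in[0.9\sigma_r^\star,1.1\sigma_r^\star]\}$ and let $U(B)\in\mathbb R^{d_1\times r}$ denote a matrix of the $r$ left singular vectors of $B$. Then there is a universal constant $c_{\mathsf{lb}}>0$ such that $$\inf_{\widehat U}\sup_{A^\star\in\mathcal M^\star}\mathbb E\Big[\min_{R\in\mathcal O^{r\times r}}\|\widehat UR-U(A^\star)\|\Big]\ge c_{\mathsf{lb}}\min\Big\{\frac{\sigma^2}{\sigma_r^{\star2}}\frac{\sqrt{d_1d_2}}{p}+\frac{\sigma}{\sigma_r^\star}\sqrt{\frac{d_1}{p}},\,1\Big\},$$ $$\inf_{\widehat U}\sup_{A^\star\in\mathcal M^\star}\mathbb E\Big[\min_{R\in\mathcal O^{r\times r}}\|\widehat UR-U(A^\star)\|_{2,\infty}\Big]\ge \frac{c_{\mathsf{lb}}}{\sqrt{d_1}}\min\Big\{\frac{\sigma^2}{\sigma_r^{\star2}}\frac{\sqrt{d_1d_2}}{p}+\frac{\sigma}{\sigma_r^\star}\sqrt{\frac{d_1}{p}},\,1\Big\},$$ where the infimum is over all estimators of $U(A^\star)$ based on $\mathcal P_\Omega(A^\star+N)$ (and $\Omega$).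
   Context: $\mathcal P_\Omega(M)$ keeps the entries of $M$ indexed by $\Omega$ and zeros out the rest. $\mathcal O^{r\times r}$ is the set of $r\times r$ orthogonal matrices; $\|\cdot\|$ is the spectral norm; $\|M\|_{2,\infty}$ is the largest row $\ell_2$ norm. *)

theory Defs
  imports "HOL-Probability.Probability" "Jordan_Normal_Form.DL_Rank"
begin

text \<open>Matrices are Jordan_Normal_Form matrices (type real mat) with explicit dimensions,
  so that the universal constant can be quantified outside all dimensions.\<close>

definition vnorm :: "real vec \<Rightarrow> real" where
  "vnorm v = sqrt (\<Sum>i<dim_vec v. (v $ i)^2)"

definition spec_norm :: "real mat \<Rightarrow> real" where
  "spec_norm A = Sup {vnorm (A *\<^sub>v x) | x. x \<in> carrier_vec (dim_col A) \<and> vnorm x = 1}"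

definition norm_2inf :: "real mat \<Rightarrow> real" where
  "norm_2inf A = Max (insert 0 {vnorm (row A i) | i. i < dim_row A})"

definition mrank :: "real mat \<Rightarrow> nat" where
  "mrank A = vec_space.rank (dim_row A) A"

definition orth_mats :: "nat \<Rightarrow> real mat set" where
  "orth_mats r = {R. R \<in> carrier_mat r r \<and> R * transpose_mat R = 1\<^sub>m r \<and> transpose_mat R * R = 1\<^sub>m r}"

definition compact_svd :: "nat \<Rightarrow> nat \<Rightarrow> nat \<Rightarrow> real mat \<Rightarrow> real mat \<Rightarrow> (nat \<Rightarrow> real) \<Rightarrow> real mat \<Rightarrow> bool" where
  "compact_svd d1 d2 r B U s V \<longleftrightarrow>
     B \<in> carrier_mat d1 d2 \<and> U \<in> carrier_mat d1 r \<and> V \<in> carrier_mat d2 r \<and>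
     transpose_mat U * U = 1\<^sub>m r \<and> transpose_mat V * V = 1\<^sub>m r \<and>
     (\<forall>k<r. s k > 0) \<and> (\<forall>k l. k \<le> l \<longrightarrow> l < r \<longrightarrow> s l \<le> s k) \<and>
     B = U * mat r r (\<lambda>(i,j). if i = j then s i else 0) * transpose_mat V"

definition sigma_r :: "nat \<Rightarrow> nat \<Rightarrow> nat \<Rightarrow> real mat \<Rightarrow> real" where
  "sigma_r d1 d2 r B = (SOME t. \<exists>U s V. compact_svd d1 d2 r B U s V \<and> t = s (r - 1))"

definition left_sv :: "nat \<Rightarrow> nat \<Rightarrow> nat \<Rightarrow> real mat \<Rightarrow> real mat" where
  "left_sv d1 d2 r B = (SOME U. \<exists>s V. compact_svd d1 d2 r B U s V)"

definition Mstar :: "nat \<Rightarrow> nat \<Rightarrow> nat \<Rightarrow> real \<Rightarrow> real mat set" where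
  "Mstar d1 d2 r ss = {B. B \<in> carrier_mat d1 d2 \<and> mrank B = r \<and>
      0.9 * ss \<le> sigma_r d1 d2 r B \<and> sigma_r d1 d2 r B \<le> 1.1 * ss}"

text \<open>Randomness: for each index (i,j) an independent pair (N_ij, indicator of (i,j) in Omega),
  N_ij ~ N(0, sigma^2), indicator ~ Bernoulli(p), all independent.\<close>
definition idx :: "nat \<Rightarrow> nat \<Rightarrow> (nat \<times> nat) set" where
  "idx d1 d2 = {..<d1} \<times> {..<d2}"

definition noise_mask :: "nat \<Rightarrow> nat \<Rightarrow> real \<Rightarrow> real \<Rightarrow> (nat \<times> nat \<Rightarrow> real \<times> bool) measure" where
  "noise_mask d1 d2 \<sigma> p =
     (\<Pi>\<^sub>M ij\<in>idx d1 d2. (density lborel (normal_density 0 \<sigma>) \<Otimes>\<^sub>M measure_pmf (bernoulli_pmf p)))"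

definition obs_space :: "nat \<Rightarrow> nat \<Rightarrow> (nat \<times> nat \<Rightarrow> real \<times> bool) measure" where
  "obs_space d1 d2 = (\<Pi>\<^sub>M ij\<in>idx d1 d2. (borel \<Otimes>\<^sub>M count_space UNIV))"

definition observe :: "nat \<Rightarrow> nat \<Rightarrow> real mat \<Rightarrow> (nat \<times> nat \<Rightarrow> real \<times> bool) \<Rightarrow> (nat \<times> nat \<Rightarrow> real \<times> bool)" where
  "observe d1 d2 A \<omega> = (\<lambda>ij\<in>idx d1 d2.
     (if snd (\<omega> ij) then A $$ ij + fst (\<omega> ij) else 0, snd (\<omega> ij)))"

definition estimators :: "nat \<Rightarrow> nat \<Rightarrow> nat \<Rightarrow> ((nat \<times> nat \<Rightarrow> real \<times> bool) \<Rightarrow> real mat) set" where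
  "estimators d1 d2 r = {Uh. (\<forall>y. Uh y \<in> carrier_mat d1 r) \<and>
      (\<forall>i<d1. \<forall>j<r. (\<lambda>y. Uh y $$ (i,j)) \<in> borel_measurable (obs_space d1 d2))}"

definition rot_loss :: "(real mat \<Rightarrow> real) \<Rightarrow> nat \<Rightarrow> real mat \<Rightarrow> real mat \<Rightarrow> real" where
  "rot_loss nm r Uh U = Inf {nm (Uh * R - U) | R. R \<in> orth_mats r}"

definition minimax_risk :: "(real mat \<Rightarrow> real) \<Rightarrow> nat \<Rightarrow> nat \<Rightarrow> nat \<Rightarrow> real \<Rightarrow> real \<Rightarrow> real \<Rightarrow> ennreal" where
  "minimax_risk nm d1 d2 r \<sigma> p ss =
     (INF Uh\<in>estimators d1 d2 r. SUP A\<in>Mstar d1 d2 r ss.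
        \<integral>\<^sup>+ \<omega>. ennreal (rot_loss nm r (Uh (observe d1 d2 A \<omega>)) (left_sv d1 d2 r A)) \<partial>noise_mask d1 d2 \<sigma> p)"

end

theory Submission
  imports Defs
begin

text \<open>A two-layer prior is placed on the signal: \<open>ss * (u v\<^sup>T + E)\<close> with \<open>E\<close> a fixed partial identity of
  rank \<open>r - 1\<close>. The vector \<open>u\<close> has a large first entry and entries \<open>\<plusminus>\<delta> / sqrt m\<close> on the
  \<open>m = d1 - r\<close> free rows, and \<open>v\<close> has independent fair random signs on the \<open>n = d2 - r + 1\<close> free
  columns. All nonzero singular values are equal, so the left singular space is read off from
  \<open>B B\<^sup>T\<close>, and the loss is at least of order \<open>\<delta>\<close> times the proportion of wrongly decoded signs of
  \<open>u\<close>; by Assouad's lemma it remains to bound Hellinger affinities of neighbours. Averaged over the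
  sign of \<open>v\<close>, the laws of a column under two neighbours differ by \<open>2 f g\<close>, where \<open>f\<close> and \<open>g\<close> are
  the odd parts of the likelihoods of the flipped entry and of the rest of the column. The loss of
  affinity is therefore a product of two information terms, of which the second is at most
  \<open>min 1 (p ss\<^sup>2 / (n \<sigma>\<^sup>2))\<close>: the bound 1 gives the linear rate, the other one the quadratic rate.\<close>

section \<open>Singular value decompositions with equal singular values\<close>

text \<open>\<open>sigma_r\<close> and \<open>left_sv\<close> are arbitrary choices among
  decompositions, so an individual singular vector says nothing. With all singular values equal to
  \<open>ss\<close>, the projector on the left singular space is the same for every choice. If the
  signs of v were known, flipping one sign of u would cost information of order \<delta>^2 / (q m)
  over all columns, with q = \<sigma>^2 / (p ss^2), and only the linear rate would follow. With a
  random sign, a column speaks about one entry of u only as far as the rest of that column reveals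
  the sign, and the rest has squared amplitude at most ss^2 / n. The total loss of affinity is thus
  at most \<delta>^2 / (q m) * min 1 (1 / (q n)). Keeping it below 1/4 allows \<delta> of order max
  (sqrt (q m)) (q sqrt (m n)), capped by a constant. Since 2 r \<le> d1, m is comparable to d1. But
  n may be far below d2, and then the construction misses the quadratic term; in that regime d2
  \<le> d1, so this term is absorbed by the linear one and the cap.\<close>

definition diag_real :: "nat \<Rightarrow> (nat \<Rightarrow> real) \<Rightarrow> real mat" where
  "diag_real r s = mat r r (\<lambda>(i,j). if i = j then s i else 0)"

lemma diag_real_carrier [simp]:
  "diag_real r s \<in> carrier_mat r r" "dim_row (diag_real r s) = r" "dim_col (diag_real r s) = r"
  by (simp_all add: diag_real_def)

lemma transpose_diag_real [simp]: "transpose_mat (diag_real r s) = diag_real r s"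
  by (auto simp: diag_real_def)

lemma mult_diag_real: "diag_real r s * diag_real r t = diag_real r (\<lambda>k. s k * t k)"
  unfolding diag_real_def by (intro eq_matI) (auto simp: scalar_prod_def if_distrib sum.delta' cong: if_cong)

lemma diag_real_one: "diag_real r (\<lambda>_. 1) = 1\<^sub>m r"
  by (auto simp: diag_real_def)

lemma diag_real_eqD: "diag_real r s = diag_real r t \<Longrightarrow> k < r \<Longrightarrow> s k = t k"
  unfolding diag_real_def by (drule arg_cong[where f = "\<lambda>A. A $$ (k, k)"]) simp

lemma diag_real_cong: "(\<And>k. k < r \<Longrightarrow> s k = t k) \<Longrightarrow> diag_real r s = diag_real r t"
  by (auto simp: diag_real_def)

lemma compact_svd_diag_real:
  "compact_svd d1 d2 r B U s V \<longleftrightarrow>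
     B \<in> carrier_mat d1 d2 \<and> U \<in> carrier_mat d1 r \<and> V \<in> carrier_mat d2 r \<and>
     transpose_mat U * U = 1\<^sub>m r \<and> transpose_mat V * V = 1\<^sub>m r \<and>
     (\<forall>k<r. s k > 0) \<and> (\<forall>k l. k \<le> l \<longrightarrow> l < r \<longrightarrow> s l \<le> s k) \<and>
     B = U * diag_real r s * transpose_mat V"
  unfolding compact_svd_def diag_real_def ..

lemma compact_svdD:
  assumes "compact_svd d1 d2 r B U s V"
  shows "B \<in> carrier_mat d1 d2" "U \<in> carrier_mat d1 r" "V \<in> carrier_mat d2 r"
    "transpose_mat U * U = 1\<^sub>m r" "transpose_mat V * V = 1\<^sub>m r" "\<And>k. k < r \<Longrightarrow> s k > 0"
    "B = U * diag_real r s * transpose_mat V"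
  using assms unfolding compact_svd_diag_real by blast+

lemma svd_mult:
  fixes U :: "'a :: comm_ring_1 mat"
  assumes U: "U \<in> carrier_mat d1 r" and V: "V \<in> carrier_mat d2 r" and W: "W \<in> carrier_mat d3 r"
    and VV: "transpose_mat V * V = 1\<^sub>m r"
    and D: "D \<in> carrier_mat r r" "E \<in> carrier_mat r r"
  shows "(U * D * transpose_mat V) * (V * E * transpose_mat W) = U * (D * E) * transpose_mat W"
proof -
  have VEW: "V * E * transpose_mat W = V * (E * transpose_mat W)"
    using D V W by (intro assoc_mult_mat[of _ d2 r _ r _ d3]) auto
  have "(U * D * transpose_mat V) * (V * E * transpose_mat W) =
      (U * D) * (transpose_mat V * (V * (E * transpose_mat W)))"
    unfolding VEW using U D V W by (intro assoc_mult_mat[of _ d1 r _ d2 _ d3]) auto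
  also have "transpose_mat V * (V * (E * transpose_mat W)) = transpose_mat V * V * (E * transpose_mat W)"
    using D V W by (intro assoc_mult_mat[of _ r d2 _ r _ d3, symmetric]) auto
  also have "\<dots> = E * transpose_mat W"
    unfolding VV using carrier_matD[OF D(2)] by simp
  also have "(U * D) * (E * transpose_mat W) = U * D * E * transpose_mat W"
    using U D W by (intro assoc_mult_mat[of _ d1 r _ r _ d3, symmetric]) auto
  also have "U * D * E = U * (D * E)"
    using U D by (intro assoc_mult_mat[of _ d1 r _ r _ r]) auto
  finally show ?thesis .
qed

lemma svd_transpose:
  assumes U: "U \<in> carrier_mat d1 r" and V: "V \<in> carrier_mat d2 r"
  shows "transpose_mat (U * diag_real r s * transpose_mat V) = V * diag_real r s * transpose_mat U"
proof -
  have "transpose_mat (U * diag_real r s * transpose_mat V) =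
     transpose_mat (transpose_mat V) * transpose_mat (U * diag_real r s)"
    using U V by (intro transpose_mult[of _ d1 r _ d2]) auto
  also have "\<dots> = V * (diag_real r s * transpose_mat U)"
    using U by (subst transpose_mult[of _ d1 r _ r]) auto
  also have "\<dots> = V * diag_real r s * transpose_mat U"
    using U V by (intro assoc_mult_mat[of _ d2 r _ r _ d1, symmetric]) auto
  finally show ?thesis .
qed

lemma svd_cancel:
  fixes U :: "'a :: comm_ring_1 mat"
  assumes U: "U \<in> carrier_mat d1 r" and V: "V \<in> carrier_mat d2 r"
    and UU: "transpose_mat U * U = 1\<^sub>m r" and VV: "transpose_mat V * V = 1\<^sub>m r"
    and D: "D \<in> carrier_mat r r"
  shows "transpose_mat U * (U * D * transpose_mat V) * V = D"
proof -
  have "transpose_mat U * (U * D * transpose_mat V) = transpose_mat U * (U * (D * transpose_mat V))"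
    using U V D by (subst assoc_mult_mat[of U d1 r D r _ d2]) auto
  also have "\<dots> = transpose_mat U * U * (D * transpose_mat V)"
    using U V D by (intro assoc_mult_mat[of _ r d1 _ r _ d2, symmetric]) auto
  also have "\<dots> = D * transpose_mat V" unfolding UU using carrier_matD[OF D] by simp
  also have "D * transpose_mat V * V = D * (transpose_mat V * V)"
    using V D by (intro assoc_mult_mat[of _ r r _ d2 _ r]) auto
  also have "\<dots> = D" unfolding VV using D by simp
  finally show ?thesis .
qed

text \<open>Makes the choices in \<open>sigma_r\<close> and \<open>left_sv\<close> harmless. A
  decomposition with constant value c gives B B^T B = c^2 B; reading this in any other decomposition
  and cancelling its orthonormal factors gives s^3 = c^2 s, so s = c. Then B B^T is c^2 times either
  projector.\<close>

lemma compact_svd_equal_values: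
  assumes svd: "compact_svd d1 d2 r B U (\<lambda>_. c) V" and svd': "compact_svd d1 d2 r B U' s V'"
  shows "k < r \<Longrightarrow> s k = c" and "U' * transpose_mat U' = U * transpose_mat U"
proof -
  note S = compact_svdD(1-6)[OF svd] and S' = compact_svdD(1-6)[OF svd']
  note B1 = compact_svdD(7)[OF svd] and B2 = compact_svdD(7)[OF svd']
  have gram: "B * transpose_mat B = W * diag_real r (\<lambda>k. t k * t k) * transpose_mat W"
    and cube: "B * transpose_mat B * B = W * diag_real r (\<lambda>k. t k * t k * t k) * transpose_mat X"
    if "compact_svd d1 d2 r B W t X" for W t X
  proof -
    note T = compact_svdD(1-5)[OF that] and B = compact_svdD(7)[OF that]
    show *: "B * transpose_mat B = W * diag_real r (\<lambda>k. t k * t k) * transpose_mat W"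
      unfolding B using T by (subst svd_transpose[of W d1 r X d2], simp, simp)
        (subst svd_mult[of W d1 r X d2 W d1], auto simp: mult_diag_real)
    show "B * transpose_mat B * B = W * diag_real r (\<lambda>k. t k * t k * t k) * transpose_mat X"
      unfolding * using T
      by (subst B, subst svd_mult[of W d1 r W d1 X d2], auto simp: mult_diag_real)
  qed
  have "W * diag_real r (\<lambda>k. a k * t k) * transpose_mat X = b \<cdot>\<^sub>m (W * diag_real r t * transpose_mat X)"
    if "W \<in> carrier_mat n r" "X \<in> carrier_mat n' r" "\<And>k. k < r \<Longrightarrow> a k = b" for W X a b t n n'
  proof -
    have "diag_real r (\<lambda>k. a k * t k) = b \<cdot>\<^sub>m diag_real r t"
      using that by (auto simp: diag_real_def)
    then have "W * diag_real r (\<lambda>k. a k * t k) * transpose_mat X = W * (b \<cdot>\<^sub>m diag_real r t) * transpose_mat X"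
      by simp
    also have "W * (b \<cdot>\<^sub>m diag_real r t) = b \<cdot>\<^sub>m (W * diag_real r t)"
      using that by (intro mult_smult_distrib[of _ n r _ r]) auto
    also have "\<dots> * transpose_mat X = b \<cdot>\<^sub>m (W * diag_real r t * transpose_mat X)"
      using that by (intro mult_smult_assoc_mat[of _ n r _ n']) auto
    finally show ?thesis .
  qed
  note scal = this
  have "U' * diag_real r (\<lambda>k. s k * s k * s k) * transpose_mat V' = c * c \<cdot>\<^sub>m B"
    unfolding cube[OF svd', symmetric] cube[OF svd] by (subst B1) (rule scal[OF S(2,3) refl])
  also have "\<dots> = U' * diag_real r (\<lambda>k. c * c * s k) * transpose_mat V'"
    by (subst B2) (rule scal[OF S'(2,3) refl, symmetric])
  finally have "transpose_mat U' * (U' * diag_real r (\<lambda>k. s k * s k * s k) * transpose_mat V') * V' =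
     transpose_mat U' * (U' * diag_real r (\<lambda>k. c * c * s k) * transpose_mat V') * V'" by simp
  then have "diag_real r (\<lambda>k. s k * s k * s k) = diag_real r (\<lambda>k. c * c * s k)"
    using S' by (subst (asm) (1 2) svd_cancel[of U' d1 r V' d2]) auto
  then have sc: "s k = c" if "k < r" for k
  proof -
    have "s k * s k * s k = c * c * s k" using diag_real_eqD[OF \<open>diag_real _ _ = _\<close> that] .
    moreover have "s k > 0" "c > 0" using S(6) S'(6) that by auto
    ultimately have "s k * s k = c * c" by simp
    then show ?thesis using \<open>s k > 0\<close> \<open>c > 0\<close> by (metis less_imp_le power2_eq_imp_eq power2_eq_square)
  qed
  then show "k < r \<Longrightarrow> s k = c" .
  show "U' * transpose_mat U' = U * transpose_mat U"
  proof (cases "r = 0")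
    case True
    then show ?thesis using S(2) S'(2) by (intro eq_matI) (auto simp: scalar_prod_def)
  next
    case False
    then have c: "c > 0" using S(6) by auto
    have one: "W * diag_real r (\<lambda>_. 1) * transpose_mat W = W * transpose_mat W" if "W \<in> carrier_mat d1 r" for W
      using that by (simp add: diag_real_one)
    have "c * c \<cdot>\<^sub>m (U' * transpose_mat U') = U' * diag_real r (\<lambda>k. s k * s k) * transpose_mat U'"
      using scal[OF S'(2,2), of "\<lambda>k. s k * s k" "c * c" "\<lambda>_. 1"] sc one[OF S'(2)] by simp
    also have "\<dots> = U * diag_real r (\<lambda>_. c * c) * transpose_mat U"
      unfolding gram[OF svd', symmetric] by (rule gram[OF svd])
    also have "\<dots> = c * c \<cdot>\<^sub>m (U * transpose_mat U)"
      using scal[OF S(2,2) refl, of "c * c" "\<lambda>_. 1"] one[OF S(2)] by simp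
    finally have eq: "c * c \<cdot>\<^sub>m (U' * transpose_mat U') = c * c \<cdot>\<^sub>m (U * transpose_mat U)" .
    show ?thesis
    proof (rule eq_matI)
      fix i j assume "i < dim_row (U * transpose_mat U)" "j < dim_col (U * transpose_mat U)"
      then show "(U' * transpose_mat U') $$ (i, j) = (U * transpose_mat U) $$ (i, j)"
        using arg_cong[OF eq, of "\<lambda>A. A $$ (i, j)"] c S(2) S'(2) by simp
    qed (use S(2) S'(2) in auto)
  qed
qed

text \<open>B = U (D V^T) and U = B (V D^-1) give equal column spaces, and U has independent columns
  because U^T is a left inverse.\<close>

lemma mrank_compact_svd:
  assumes "compact_svd d1 d2 r B U s V"
  shows "mrank B = r"
proof -
  note S = compact_svdD(1-5)[OF assms] and B = compact_svdD(7)[OF assms]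
  have dims: "dim_row B = d1" "dim_col B = d2" "dim_row U = d1" "dim_col U = r" using S by auto
  interpret vec_space "TYPE(real)" d1 .
  let ?D = "diag_real r s" and ?E = "diag_real r (\<lambda>k. 1 / s k)"
  have DE: "?D * ?E = 1\<^sub>m r"
    unfolding mult_diag_real diag_real_one[symmetric] using compact_svdD(6)[OF assms]
    by (intro diag_real_cong) fastforce
  have DV: "?D * transpose_mat V \<in> carrier_mat r d2"
    by (rule mult_carrier_mat[of _ r r]) (use S in auto)
  have c1: "\<exists>x\<in>carrier_vec r. U *\<^sub>v x = B *\<^sub>v y" if y: "y \<in> carrier_vec d2" for y
  proof
    have "B *\<^sub>v y = U *\<^sub>v (?D * transpose_mat V *\<^sub>v y)"
      unfolding B using S y DV
      by (subst assoc_mult_mat[of U d1 r _ r _ d2]) (auto intro!: assoc_mult_mat_vec)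
    then show "U *\<^sub>v (?D * transpose_mat V *\<^sub>v y) = B *\<^sub>v y" by simp
    show "?D * transpose_mat V *\<^sub>v y \<in> carrier_vec r"
      using DV y by (rule mult_mat_vec_carrier)
  qed
  have BV: "B * (V * ?E) = U"
  proof -
    have "B * (V * ?E) = B * (V * ?E * transpose_mat (1\<^sub>m r))" using S by simp
    also have "\<dots> = U * (?D * ?E) * transpose_mat (1\<^sub>m r)"
      unfolding B using S by (intro svd_mult[of _ d1 r _ d2 _ r]) auto
    also have "\<dots> = U" using S by (simp add: DE)
    finally show ?thesis .
  qed
  have c2: "\<exists>y\<in>carrier_vec d2. B *\<^sub>v y = U *\<^sub>v x" if x: "x \<in> carrier_vec r" for x
  proof
    have "B * (V * ?E) *\<^sub>v x = B *\<^sub>v (V * ?E *\<^sub>v x)"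
      using S x by (intro assoc_mult_mat_vec[of _ d1 d2 _ r]) auto
    then show "B *\<^sub>v (V * ?E *\<^sub>v x) = U *\<^sub>v x" by (simp add: BV)
    show "V * ?E *\<^sub>v x \<in> carrier_vec d2"
      using S x by (intro mult_mat_vec_carrier[of _ d2 r]) auto
  qed
  have "col_space B = col_space U"
    unfolding col_space_eq[OF S(1)] col_space_eq[OF S(2)] dims
    by (intro Collect_cong conj_cong refl) (metis c1 c2)
  then have "rank B = rank U"
    unfolding rank_def col_space_def by simp
  moreover have "rank U = r"
  proof (rule lin_indpt_full_rank)
    show U: "U \<in> carrier_mat d1 r" using S by blast
    have inj: "x = 0\<^sub>v r" if "x \<in> carrier_vec r" "U *\<^sub>v x = 0\<^sub>v d1" for x
    proof -
      have "transpose_mat U *\<^sub>v (U *\<^sub>v x) = transpose_mat U * U *\<^sub>v x"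
        using S that by (intro assoc_mult_mat_vec[symmetric, of _ r d1 _ r]) auto
      then show ?thesis using S that by auto
    qed
    \<comment> \<open>\<open>lin_depE\<close> speaks of the set of columns, so repetitions must be
      excluded: two equal columns would put a 1 off the diagonal of U^T U.\<close>
    show dist: "distinct (cols U)"
      unfolding distinct_conv_nth
    proof (intro allI impI)
      fix i j assume ij: "i < length (cols U)" "j < length (cols U)" "i \<noteq> j"
      then have ij': "i < r" "j < r" by (auto simp: dims)
      show "cols U ! i \<noteq> cols U ! j"
      proof
        assume "cols U ! i = cols U ! j"
        then have eq: "col U i = col U j" using ij by simp
        have "(transpose_mat U * U) $$ (i, j) = (transpose_mat U * U) $$ (j, j)"
          using ij' eq U by simp
        then show False using S ij' ij by simp
      qed
    qed
    show "lin_indpt (set (cols U))"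
      using lin_depE[OF U _ dist] inj by metis
  qed
  ultimately show ?thesis unfolding mrank_def by (simp add: dims)
qed

lemma
  assumes svd: "compact_svd d1 d2 r B U (\<lambda>_. ss) V" and r: "1 \<le> r" and ss: "ss > 0"
  shows compact_svd_in_Mstar: "B \<in> Mstar d1 d2 r ss"
    and left_sv_compact_svd: "left_sv d1 d2 r B \<in> carrier_mat d1 r"
      "transpose_mat (left_sv d1 d2 r B) * left_sv d1 d2 r B = 1\<^sub>m r"
      "left_sv d1 d2 r B * transpose_mat (left_sv d1 d2 r B) = U * transpose_mat U"
proof -
  have "\<exists>U s V. compact_svd d1 d2 r B U s V \<and> sigma_r d1 d2 r B = s (r - 1)"
    unfolding sigma_r_def by (rule someI_ex) (use svd in blast)
  then have "sigma_r d1 d2 r B = ss"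
    using compact_svd_equal_values(1)[OF svd, of _ _ _ "r - 1"] r by auto
  then show "B \<in> Mstar d1 d2 r ss"
    using mrank_compact_svd[OF svd] svd ss unfolding Mstar_def compact_svd_def by auto
  have "\<exists>s V. compact_svd d1 d2 r B (left_sv d1 d2 r B) s V"
    unfolding left_sv_def by (rule someI_ex) (use svd in blast)
  then obtain s V' where "compact_svd d1 d2 r B (left_sv d1 d2 r B) s V'" by blast
  from compact_svd_equal_values(2)[OF svd this] this
  show "left_sv d1 d2 r B \<in> carrier_mat d1 r"
      "transpose_mat (left_sv d1 d2 r B) * left_sv d1 d2 r B = 1\<^sub>m r"
      "left_sv d1 d2 r B * transpose_mat (left_sv d1 d2 r B) = U * transpose_mat U"
    by (auto simp: compact_svd_def)
qed

section \<open>Norms and decoding from the Gram matrix\<close>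

lemma vnorm_L2_set: "vnorm v = L2_set (\<lambda>i. v $ i) {..<dim_vec v}"
  by (simp add: vnorm_def L2_set_def)

lemma vnorm_nonneg [simp]: "vnorm v \<ge> 0"
  by (simp add: vnorm_def sum_nonneg)

lemma vnorm_power2: "(vnorm v)\<^sup>2 = (\<Sum>i<dim_vec v. (v $ i)\<^sup>2)"
  by (simp add: vnorm_def sum_nonneg)

lemma vnorm_smult: "vnorm (c \<cdot>\<^sub>v v) = \<bar>c\<bar> * vnorm v"
  by (simp add: vnorm_def power_mult_distrib real_sqrt_mult flip: sum_distrib_left)

lemma vnorm_triangle:
  "dim_vec v = dim_vec w \<Longrightarrow> vnorm (v + w) \<le> vnorm v + vnorm w"
  using L2_set_triangle_ineq[of "\<lambda>i. v $ i" "\<lambda>i. w $ i" "{..<dim_vec w}"]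
    L2_set_cong[of "{..<dim_vec w}" "{..<dim_vec w}" "\<lambda>i. (v + w) $ i" "\<lambda>i. v $ i + w $ i"]
  by (simp add: vnorm_L2_set)

lemma scalar_prod_self_eq_vnorm: "v \<bullet> v = (vnorm v)\<^sup>2" for v :: "real vec"
  by (simp add: vnorm_power2 scalar_prod_def lessThan_atLeast0) (simp add: power2_eq_square)

lemma scalar_prod_le_vnorm:
  fixes v w :: "real vec"
  assumes "dim_vec v = dim_vec w"
  shows "\<bar>v \<bullet> w\<bar> \<le> vnorm v * vnorm w"
proof -
  have "\<bar>v \<bullet> w\<bar> \<le> (\<Sum>i<dim_vec w. \<bar>v $ i\<bar> * \<bar>w $ i\<bar>)"
    unfolding scalar_prod_def lessThan_atLeast0 by (rule order_trans[OF sum_abs]) (simp add: abs_mult)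
  also have "\<dots> \<le> vnorm v * vnorm w"
    unfolding vnorm_L2_set assms by (rule L2_set_mult_ineq)
  finally show ?thesis .
qed

lemma abs_component_le_vnorm: "i < dim_vec v \<Longrightarrow> \<bar>v $ i\<bar> \<le> vnorm v"
  unfolding vnorm_L2_set using member_le_L2_set[of "{..<dim_vec v}" i "\<lambda>i. \<bar>v $ i\<bar>"]
  by (simp add: L2_set_def)

lemma vnorm_mult_mat_vec_le:
  assumes "E \<in> carrier_mat d r" "x \<in> carrier_vec r"
  shows "vnorm (E *\<^sub>v x) \<le> L2_set (\<lambda>i. vnorm (row E i)) {..<d} * vnorm x"
proof -
  have "vnorm (E *\<^sub>v x) = L2_set (\<lambda>i. \<bar>row E i \<bullet> x\<bar>) {..<d}"
    using assms by (simp add: vnorm_L2_set L2_set_def)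
  also have "\<dots> \<le> L2_set (\<lambda>i. vnorm (row E i) * vnorm x) {..<d}"
    using assms by (intro L2_set_mono scalar_prod_le_vnorm) auto
  also have "\<dots> = L2_set (\<lambda>i. vnorm (row E i)) {..<d} * vnorm x"
    by (simp add: L2_set_left_distrib)
  finally show ?thesis .
qed

text \<open>A real \<open>Sup\<close> dominates its elements only if the set is bounded above. The
  Frobenius norm, written as the \<open>L2_set\<close> of the row norms, is such a bound.\<close>

lemma spec_norm_ge:
  assumes E: "E \<in> carrier_mat d r" and x: "x \<in> carrier_vec r"
  shows "vnorm (E *\<^sub>v x) \<le> spec_norm E * vnorm x"
proof (cases "vnorm x = 0")
  case True
  then show ?thesis using vnorm_mult_mat_vec_le[OF assms] by simp
next
  case False
  then have pos: "vnorm x > 0" using vnorm_nonneg[of x] by linarith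
  let ?S = "{vnorm (E *\<^sub>v x) | x. x \<in> carrier_vec (dim_col E) \<and> vnorm x = 1}"
  let ?y = "(1 / vnorm x) \<cdot>\<^sub>v x"
  have "bdd_above ?S"
  proof (rule bdd_aboveI)
    fix y assume "y \<in> ?S"
    then obtain z where "z \<in> carrier_vec r" "vnorm z = 1" "y = vnorm (E *\<^sub>v z)" using E by auto
    then show "y \<le> L2_set (\<lambda>i. vnorm (row E i)) {..<d}" using vnorm_mult_mat_vec_le[OF E, of z] by simp
  qed
  moreover have "vnorm (E *\<^sub>v ?y) \<in> ?S" using E x pos by (auto simp: vnorm_smult)
  ultimately have "vnorm (E *\<^sub>v ?y) \<le> spec_norm E"
    unfolding spec_norm_def by (intro cSup_upper)
  then show ?thesis
    using E x pos by (simp add: mult_mat_vec[OF E x] vnorm_smult field_simps)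
qed

lemma vnorm_unit_vec: "i < r \<Longrightarrow> vnorm (unit_vec r i) = 1"
  by (simp add: vnorm_def if_distrib[where f = "\<lambda>x. x\<^sup>2"] cong: if_cong)

lemma spec_norm_nonneg:
  assumes "E \<in> carrier_mat d r" "0 < r"
  shows "spec_norm E \<ge> 0"
  using order_trans[OF vnorm_nonneg spec_norm_ge[OF assms(1) unit_vec_carrier[of r 0]]] assms(2)
  by (simp add: vnorm_unit_vec)

text \<open>Apply E to its own row i: component i of the result is the squared norm of that
  row.\<close>

lemma vnorm_row_le_spec_norm:
  assumes E: "E \<in> carrier_mat d r" and r: "0 < r" and i: "i < d"
  shows "vnorm (row E i) \<le> spec_norm E"
proof (cases "vnorm (row E i) = 0")
  case True
  then show ?thesis using spec_norm_nonneg[OF E r] by simp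
next
  case False
  then have pos: "vnorm (row E i) > 0" using vnorm_nonneg[of "row E i"] by linarith
  have x: "row E i \<in> carrier_vec r" using E by auto
  have "vnorm (row E i) * vnorm (row E i) = \<bar>(E *\<^sub>v row E i) $ i\<bar>"
    using E i by (simp add: scalar_prod_self_eq_vnorm power2_eq_square)
  also have "\<dots> \<le> vnorm (E *\<^sub>v row E i)" using E i by (intro abs_component_le_vnorm) auto
  also have "\<dots> \<le> spec_norm E * vnorm (row E i)" by (rule spec_norm_ge[OF E x])
  finally show ?thesis using pos by simp
qed

text \<open>The Frobenius norm lies in between. This carries the spectral lower bound over to the
  row norm and is the source of the factor 1 / sqrt d1 there.\<close>

lemma spec_norm_le_norm_2inf:
  assumes E: "E \<in> carrier_mat d r" and r: "0 < r"
  shows "spec_norm E \<le> sqrt (real d) * norm_2inf E"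
proof -
  have fin: "finite (insert 0 {vnorm (row E i) | i. i < dim_row E})" by simp
  have row: "vnorm (row E i) \<le> norm_2inf E" if "i < d" for i
    unfolding norm_2inf_def using fin that E by (intro Max_ge) auto
  have n: "norm_2inf E \<ge> 0" unfolding norm_2inf_def using fin by (intro Max_ge) auto
  have "spec_norm E \<le> L2_set (\<lambda>i. vnorm (row E i)) {..<d}"
    unfolding spec_norm_def
  proof (rule cSup_least)
    have "vnorm (E *\<^sub>v unit_vec r 0) \<in> {vnorm (E *\<^sub>v x) |x. x \<in> carrier_vec (dim_col E) \<and> vnorm x = 1}"
      using E r vnorm_unit_vec[of 0 r] by auto
    then show "{vnorm (E *\<^sub>v x) |x. x \<in> carrier_vec (dim_col E) \<and> vnorm x = 1} \<noteq> {}" by blast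
  next
    fix y assume "y \<in> {vnorm (E *\<^sub>v x) |x. x \<in> carrier_vec (dim_col E) \<and> vnorm x = 1}"
    then obtain z where "z \<in> carrier_vec r" "vnorm z = 1" "y = vnorm (E *\<^sub>v z)" using E by auto
    then show "y \<le> L2_set (\<lambda>i. vnorm (row E i)) {..<d}" using vnorm_mult_mat_vec_le[OF E, of z] by simp
  qed
  also have "\<dots> \<le> L2_set (\<lambda>_. norm_2inf E) {..<d}"
    using row by (intro L2_set_mono) auto
  also have "\<dots> = sqrt (real d) * norm_2inf E"
    using n by (simp add: L2_set_def real_sqrt_mult)
  finally show ?thesis .
qed

lemma vnorm_orthonormal_mult:
  assumes U: "U \<in> carrier_mat d r" "transpose_mat U * U = 1\<^sub>m r" and x: "x \<in> carrier_vec r"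
  shows "vnorm (U *\<^sub>v x) = vnorm x"
proof -
  have "(U *\<^sub>v x) \<bullet> (U *\<^sub>v x) = (transpose_mat U *\<^sub>v (U *\<^sub>v x)) \<bullet> x"
    using U x by (intro transpose_vec_mult_scalar[symmetric, of _ d r]) auto
  also have "transpose_mat U *\<^sub>v (U *\<^sub>v x) = transpose_mat U * U *\<^sub>v x"
    using U x by (intro assoc_mult_mat_vec[symmetric, of _ r d _ r]) auto
  also have "\<dots> = x" unfolding U(2) using x by simp
  finally have "(vnorm (U *\<^sub>v x))\<^sup>2 = (vnorm x)\<^sup>2" by (simp add: scalar_prod_self_eq_vnorm)
  then show ?thesis by (simp add: power2_eq_iff_nonneg)
qed

text \<open>The Gram matrix is invariant under the unknown rotation, so its column can be read off the
  estimator.\<close>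

lemma gram_column_error_le:
  assumes Uh: "Uh \<in> carrier_mat d r" and U: "U \<in> carrier_mat d r" "transpose_mat U * U = 1\<^sub>m r"
    and R: "R \<in> orth_mats r" and r: "0 < r" and j: "j < d"
    and diag: "(U * transpose_mat U) $$ (j, j) \<le> 1"
    and t1: "spec_norm (Uh * R - U) \<le> 1"
  shows "(\<Sum>i<d. ((Uh * transpose_mat Uh) $$ (i, j) - (U * transpose_mat U) $$ (i, j))\<^sup>2)
    \<le> (3 * spec_norm (Uh * R - U))\<^sup>2"
proof -
  define X where "X = Uh * R"
  define E where "E = Uh * R - U"
  have Rc: "R \<in> carrier_mat r r" "R * transpose_mat R = 1\<^sub>m r" using R by (auto simp: orth_mats_def)
  have X: "X \<in> carrier_mat d r" unfolding X_def using Uh Rc by auto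
  have E: "E \<in> carrier_mat d r" and EX: "E = X - U" unfolding E_def X_def using U by auto
  have "X * transpose_mat X = Uh * R * (transpose_mat R * transpose_mat Uh)"
    unfolding X_def using Uh Rc by (subst transpose_mult[of _ d r _ r]) auto
  also have "\<dots> = Uh * (R * (transpose_mat R * transpose_mat Uh))"
    using Uh Rc by (intro assoc_mult_mat[of _ d r _ r _ d]) auto
  also have "R * (transpose_mat R * transpose_mat Uh) = R * transpose_mat R * transpose_mat Uh"
    using Uh Rc by (intro assoc_mult_mat[symmetric, of _ r r _ r _ d]) auto
  also have "\<dots> = transpose_mat Uh" unfolding Rc(2) using Uh by simp
  finally have XX: "X * transpose_mat X = Uh * transpose_mat Uh" .
  let ?x = "row X j" and ?u = "row U j" and ?e = "row E j" and ?t = "spec_norm E"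
  have rows: "?x \<in> carrier_vec r" "?u \<in> carrier_vec r" "?e \<in> carrier_vec r" using X U E by auto
  have xue: "?x = ?u + ?e" using X U j by (intro eq_vecI) (auto simp: EX)
  have e: "vnorm ?e \<le> ?t" by (rule vnorm_row_le_spec_norm[OF E r j])
  have t: "0 \<le> ?t" by (rule spec_norm_nonneg[OF E r])
  have "(vnorm ?u)\<^sup>2 \<le> 1\<^sup>2"
    using diag U j by (simp add: scalar_prod_self_eq_vnorm)
  then have u: "vnorm ?u \<le> 1" by (rule power2_le_imp_le) simp
  have x: "vnorm ?x \<le> 1 + ?t"
    using vnorm_triangle[of ?u ?e] carrier_vecD[OF rows(2)] carrier_vecD[OF rows(3)] u e unfolding xue by linarith
  \<comment> \<open>With X = U + E, column j of X X^T - U U^T equals E x + U e, where x and e are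
    the j-th rows of X and E. The second part keeps the norm of e since U has orthonormal
    columns.\<close>
  define v where "v = E *\<^sub>v ?x + U *\<^sub>v ?e"
  have v: "v $ i = (Uh * transpose_mat Uh) $$ (i, j) - (U * transpose_mat U) $$ (i, j)" if i: "i < d" for i
  proof -
    have rowE: "row E i = row X i - row U i" using X U i by (intro eq_vecI) (auto simp: EX)
    have ri: "row X i \<in> carrier_vec r" "row U i \<in> carrier_vec r" using X U by auto
    have eq: "?e = ?x - ?u" using X U j by (intro eq_vecI) (auto simp: EX)
    have "v $ i = row E i \<bullet> ?x + row U i \<bullet> ?e" unfolding v_def using E U i by simp
    also have "row E i \<bullet> ?x = row X i \<bullet> ?x - row U i \<bullet> ?x"
      unfolding rowE using ri rows by (intro minus_scalar_prod_distrib[of _ r]) auto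
    also have "row U i \<bullet> ?e = row U i \<bullet> ?x - row U i \<bullet> ?u"
      unfolding eq using ri rows by (intro scalar_prod_minus_distrib[of _ r]) auto
    finally show ?thesis unfolding XX[symmetric] using X U i j by simp
  qed
  have dv: "dim_vec v = d" unfolding v_def using U by simp
  have "vnorm v \<le> vnorm (E *\<^sub>v ?x) + vnorm (U *\<^sub>v ?e)"
    unfolding v_def using E U by (intro vnorm_triangle) auto
  also have "\<dots> \<le> ?t * (1 + ?t) + ?t"
    using spec_norm_ge[OF E rows(1)] vnorm_orthonormal_mult[OF U rows(3)] e
      mult_left_mono[OF x t] by linarith
  also have "\<dots> \<le> ?t * (1 + 1) + ?t"
    using t t1 by (intro add_mono mult_left_mono) (auto simp: E_def)
  finally have "vnorm v \<le> 3 * ?t" by simp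
  then have "(vnorm v)\<^sup>2 \<le> (3 * ?t)\<^sup>2" by (intro power_mono) auto
  then show ?thesis
    by (simp add: vnorm_power2 dv v E_def[symmetric])
qed

section \<open>Shifting one noisy masked entry\<close>

definition entry_law :: "real \<Rightarrow> real \<Rightarrow> (real \<times> bool) measure" where
  "entry_law \<sigma> p = density lborel (normal_density 0 \<sigma>) \<Otimes>\<^sub>M measure_pmf (bernoulli_pmf p)"

text \<open>Hidden entries stay fixed: \<open>observe\<close> erases them, so the observation is the
  same, and the likelihood ratio is 1 there. This is how the factor \<open>p\<close> enters the
  information bounds.\<close>

definition entry_shift :: "real \<Rightarrow> real \<times> bool \<Rightarrow> real \<times> bool" where
  "entry_shift a x = (if snd x then a + fst x else fst x, snd x)"

definition entry_lr :: "real \<Rightarrow> real \<Rightarrow> real \<times> bool \<Rightarrow> real" where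
  "entry_lr \<sigma> a x = (if snd x then exp (a * fst x / \<sigma>\<^sup>2 - a\<^sup>2 / (2 * \<sigma>\<^sup>2)) else 1)"

lemma entry_lr_pos: "entry_lr \<sigma> a x > 0"
  by (simp add: entry_lr_def)

lemma entry_lr_zero [simp]: "entry_lr \<sigma> 0 x = 1"
  by (simp add: entry_lr_def)

text \<open>The terms linear in the noise cancel, so the geometric mean of two opposite shifts
  depends on the mask alone.\<close>

lemma entry_lr_mult_neg:
  "entry_lr \<sigma> a x * entry_lr \<sigma> (- a) x = exp (- (of_bool (snd x) * a\<^sup>2 / \<sigma>\<^sup>2))"
  by (auto simp: entry_lr_def field_simps simp flip: exp_add)

lemma sets_entry_law [measurable_cong]:
  "sets (entry_law \<sigma> p) = sets (borel \<Otimes>\<^sub>M count_space UNIV)"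
  unfolding entry_law_def by (intro sets_pair_measure_cong) auto

lemma prob_space_entry_law: "\<sigma> > 0 \<Longrightarrow> prob_space (entry_law \<sigma> p)"
proof -
  assume "\<sigma> > 0"
  then interpret N: prob_space "density lborel (normal_density 0 \<sigma>)"
    by (rule prob_space_normal_density)
  interpret B: prob_space "measure_pmf (bernoulli_pmf p)"
    by (rule prob_space_measure_pmf)
  interpret P: pair_prob_space "density lborel (normal_density 0 \<sigma>)" "measure_pmf (bernoulli_pmf p)" ..
  show ?thesis unfolding entry_law_def by (rule P.prob_space_axioms)
qed

lemma entry_lr_measurable [measurable]:
  "entry_lr \<sigma> a \<in> borel_measurable (borel \<Otimes>\<^sub>M count_space UNIV)"
  unfolding entry_lr_def by measurable

lemma entry_shift_measurable [measurable]:
  "entry_shift a \<in> (borel \<Otimes>\<^sub>M count_space UNIV) \<rightarrow>\<^sub>M (borel \<Otimes>\<^sub>M count_space UNIV)"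
  unfolding entry_shift_def by measurable

text \<open>Translation invariance of Lebesgue measure moves the shift into the Gaussian density,
  and expanding the square splits off the ratio. The mask is integrated last, so each of its values
  is treated separately.\<close>

lemma distr_entry_shift:
  assumes s: "\<sigma> > 0"
  shows "distr (entry_law \<sigma> p) (entry_law \<sigma> p) (entry_shift a) =
         density (entry_law \<sigma> p) (\<lambda>x. ennreal (entry_lr \<sigma> a x))"
proof (rule measure_eqI)
  fix X assume "X \<in> sets (distr (entry_law \<sigma> p) (entry_law \<sigma> p) (entry_shift a))"
  then have X [measurable]: "X \<in> sets (borel \<Otimes>\<^sub>M count_space UNIV)"
    by (simp add: sets_entry_law)
  let ?N = "density lborel (normal_density 0 \<sigma>)" and ?B = "measure_pmf (bernoulli_pmf p)"
  interpret N: prob_space ?N using s by (rule prob_space_normal_density)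
  interpret B: prob_space ?B by (rule prob_space_measure_pmf)
  interpret P: pair_prob_space ?N ?B ..
  have iter: "(\<integral>\<^sup>+x. f x \<partial>entry_law \<sigma> p) = (\<integral>\<^sup>+b. (\<integral>\<^sup>+x. ennreal (normal_density 0 \<sigma> x) * f (x, b) \<partial>lborel) \<partial>?B)"
    if [measurable]: "f \<in> borel_measurable (borel \<Otimes>\<^sub>M count_space UNIV)" for f :: "real \<times> bool \<Rightarrow> ennreal"
  proof -
    have "f \<in> borel_measurable (?N \<Otimes>\<^sub>M ?B)"
      using that by (simp cong: measurable_cong_sets sets_pair_measure_cong)
    then have "(\<integral>\<^sup>+x. f x \<partial>entry_law \<sigma> p) = (\<integral>\<^sup>+b. (\<integral>\<^sup>+x. f (x, b) \<partial>?N) \<partial>?B)"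
      unfolding entry_law_def by (rule P.nn_integral_snd[symmetric])
    also have "\<dots> = (\<integral>\<^sup>+b. (\<integral>\<^sup>+x. ennreal (normal_density 0 \<sigma> x) * f (x, b) \<partial>lborel) \<partial>?B)"
      by (intro nn_integral_cong nn_integral_density) auto
    finally show ?thesis .
  qed
  have gauss: "ennreal (normal_density 0 \<sigma> (x - a)) * y =
      ennreal (normal_density 0 \<sigma> x) * (ennreal (exp (a * x / \<sigma>\<^sup>2 - a\<^sup>2 / (2 * \<sigma>\<^sup>2))) * y)" for x y
  proof -
    have "- (x - a)\<^sup>2 / (2 * \<sigma>\<^sup>2) = - x\<^sup>2 / (2 * \<sigma>\<^sup>2) + (a * x / \<sigma>\<^sup>2 - a\<^sup>2 / (2 * \<sigma>\<^sup>2))"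
      using s by (simp add: field_simps power2_eq_square)
    then have "exp (- (x - a)\<^sup>2 / (2 * \<sigma>\<^sup>2)) =
        exp (- x\<^sup>2 / (2 * \<sigma>\<^sup>2)) * exp (a * x / \<sigma>\<^sup>2 - a\<^sup>2 / (2 * \<sigma>\<^sup>2))"
      by (simp only: exp_add)
    then have "normal_density 0 \<sigma> (x - a) = normal_density 0 \<sigma> x * exp (a * x / \<sigma>\<^sup>2 - a\<^sup>2 / (2 * \<sigma>\<^sup>2))"
      by (simp add: normal_density_def)
    then show ?thesis by (simp add: ennreal_mult mult.assoc)
  qed
  have inner: "(\<integral>\<^sup>+x. ennreal (normal_density 0 \<sigma> x) * indicator X (entry_shift a (x, b)) \<partial>lborel) =
     (\<integral>\<^sup>+x. ennreal (normal_density 0 \<sigma> x) * (ennreal (entry_lr \<sigma> a (x, b)) * indicator X (x, b)) \<partial>lborel)" for b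
  proof (cases b)
    case True
    have "(\<integral>\<^sup>+x. ennreal (normal_density 0 \<sigma> (x - a)) * indicator X (x, True) \<partial>lborel) =
        (\<integral>\<^sup>+x. ennreal (normal_density 0 \<sigma> ((a + 1 * x) - a)) * indicator X (a + 1 * x, True) \<partial>lborel)"
      by (subst nn_integral_real_affine[where c = 1 and t = a]) auto
    then show ?thesis using True by (simp add: gauss entry_shift_def entry_lr_def)
  qed (simp add: entry_shift_def entry_lr_def)
  have "emeasure (distr (entry_law \<sigma> p) (entry_law \<sigma> p) (entry_shift a)) X =
      (\<integral>\<^sup>+x. indicator X x \<partial>distr (entry_law \<sigma> p) (entry_law \<sigma> p) (entry_shift a))"
    by (simp add: sets_entry_law)
  also have "\<dots> = (\<integral>\<^sup>+x. indicator X (entry_shift a x) \<partial>entry_law \<sigma> p)"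
    by (intro nn_integral_distr) auto
  also have "\<dots> = (\<integral>\<^sup>+x. ennreal (entry_lr \<sigma> a x) * indicator X x \<partial>entry_law \<sigma> p)"
    by (subst (1 2) iter) (auto simp: inner)
  also have "\<dots> = emeasure (density (entry_law \<sigma> p) (\<lambda>x. ennreal (entry_lr \<sigma> a x))) X"
    by (subst emeasure_density) (auto simp: sets_entry_law)
  finally show "emeasure (distr (entry_law \<sigma> p) (entry_law \<sigma> p) (entry_shift a)) X =
      emeasure (density (entry_law \<sigma> p) (\<lambda>x. ennreal (entry_lr \<sigma> a x))) X" .
qed simp

section \<open>Product measures: coordinatewise shifts and independence of disjoint blocks\<close>

lemma distr_PiM_pointwise:
  fixes M :: "'i \<Rightarrow> 'a measure"
  assumes fin: "finite I" and M: "\<And>i. prob_space (M i)"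
    and f [measurable]: "\<And>i. f i \<in> M i \<rightarrow>\<^sub>M M i"
    and g [measurable]: "\<And>i. g i \<in> borel_measurable (M i)"
    and eq: "\<And>i. distr (M i) (M i) (f i) = density (M i) (g i)"
  shows "distr (PiM I M) (PiM I M) (\<lambda>\<omega>. \<lambda>i\<in>I. f i (\<omega> i)) = density (PiM I M) (\<lambda>\<omega>. \<Prod>i\<in>I. g i (\<omega> i))"
proof -
  interpret M: product_prob_space M I
    by (simp add: M product_prob_spaceI)
  \<comment> \<open>Both sides are the product of these marginals; each is identified with it by its
    values on rectangles.\<close>
  define M' where "M' i = density (M i) (g i)" for i
  have M'_prob: "prob_space (M' i)" for i
    unfolding M'_def eq[symmetric] using f by (rule prob_space.prob_space_distr[OF M])
  have sets_M': "sets (PiM I M') = sets (PiM I M)"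
    by (rule sets_PiM_cong) (auto simp: M'_def)
  interpret M': product_prob_space M' I
    by (simp add: M'_prob product_prob_spaceI)
  have T: "(\<lambda>\<omega>. \<lambda>i\<in>I. f i (\<omega> i)) \<in> PiM I M \<rightarrow>\<^sub>M PiM I M"
    by measurable
  have "distr (PiM I M) (PiM I M) (\<lambda>\<omega>. \<lambda>i\<in>I. f i (\<omega> i)) = PiM I M'"
  proof (rule M'.PiM_eqI)
    fix A assume A: "\<And>i. i \<in> I \<Longrightarrow> A i \<in> sets (M' i)"
    then have A' [measurable]: "\<And>i. i \<in> I \<Longrightarrow> A i \<in> sets (M i)" by (simp add: M'_def)
    have "emeasure (distr (PiM I M) (PiM I M) (\<lambda>\<omega>. \<lambda>i\<in>I. f i (\<omega> i))) (Pi\<^sub>E I A) =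
       emeasure (PiM I M) ((\<lambda>\<omega>. \<lambda>i\<in>I. f i (\<omega> i)) -` (Pi\<^sub>E I A) \<inter> space (PiM I M))"
      by (rule emeasure_distr[OF T]) (use fin A' in \<open>auto intro!: sets_PiM_I_finite\<close>)
    also have "(\<lambda>\<omega>. \<lambda>i\<in>I. f i (\<omega> i)) -` (Pi\<^sub>E I A) \<inter> space (PiM I M) = (Pi\<^sub>E I (\<lambda>i. f i -` A i \<inter> space (M i)))"
      by (auto simp: space_PiM PiE_iff)
    also have "emeasure (PiM I M) \<dots> = (\<Prod>i\<in>I. emeasure (M i) (f i -` A i \<inter> space (M i)))"
      by (rule M.emeasure_PiM) (use fin A' in auto)
    also have "\<dots> = (\<Prod>i\<in>I. emeasure (M' i) (A i))"
      unfolding M'_def eq[symmetric] by (intro prod.cong refl emeasure_distr[symmetric]) (use A' f in auto)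
    finally show "emeasure (distr (PiM I M) (PiM I M) (\<lambda>\<omega>. \<lambda>i\<in>I. f i (\<omega> i))) (Pi\<^sub>E I A) =
      (\<Prod>i\<in>I. emeasure (M' i) (A i))" .
  qed (use fin sets_M' in auto)
  moreover have "density (PiM I M) (\<lambda>\<omega>. \<Prod>i\<in>I. g i (\<omega> i)) = PiM I M'"
  proof (rule M'.PiM_eqI)
    fix A assume A: "\<And>i. i \<in> I \<Longrightarrow> A i \<in> sets (M' i)"
    then have A' [measurable]: "\<And>i. i \<in> I \<Longrightarrow> A i \<in> sets (M i)" by (simp add: M'_def)
    have "emeasure (density (PiM I M) (\<lambda>\<omega>. \<Prod>i\<in>I. g i (\<omega> i))) (Pi\<^sub>E I A) =
        (\<integral>\<^sup>+\<omega>. (\<Prod>i\<in>I. g i (\<omega> i)) * indicator (Pi\<^sub>E I A) \<omega> \<partial>PiM I M)"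
      by (rule emeasure_density) (use fin A' in \<open>auto intro!: sets_PiM_I_finite borel_measurable_prod_ennreal\<close>)
    also have "\<dots> = (\<integral>\<^sup>+\<omega>. (\<Prod>i\<in>I. g i (\<omega> i) * indicator (A i) (\<omega> i)) \<partial>PiM I M)"
    proof (intro nn_integral_cong)
      fix \<omega> assume "\<omega> \<in> space (PiM I M)"
      then have "(\<Prod>i\<in>I. indicator (A i) (\<omega> i)) = (indicator (Pi\<^sub>E I A) \<omega> :: ennreal)"
        using fin by (auto simp: indicator_def space_PiM PiE_iff)
      then show "(\<Prod>i\<in>I. g i (\<omega> i)) * indicator (Pi\<^sub>E I A) \<omega> = (\<Prod>i\<in>I. g i (\<omega> i) * indicator (A i) (\<omega> i))"
        by (simp add: prod.distrib)
    qed
    also have "\<dots> = (\<Prod>i\<in>I. \<integral>\<^sup>+x. g i x * indicator (A i) x \<partial>M i)"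
      by (rule M.product_nn_integral_prod) (use fin in auto)
    also have "\<dots> = (\<Prod>i\<in>I. emeasure (M' i) (A i))"
      unfolding M'_def by (intro prod.cong refl emeasure_density[symmetric]) auto
    finally show "emeasure (density (PiM I M) (\<lambda>\<omega>. \<Prod>i\<in>I. g i (\<omega> i))) (Pi\<^sub>E I A) =
      (\<Prod>i\<in>I. emeasure (M' i) (A i))" .
  qed (use fin sets_M' in auto)
  ultimately show ?thesis by simp
qed

text \<open>Coordinates of a product measure are independent, hence so are their restrictions to
  disjoint blocks; \<open>dep\<close> makes each factor a function of its block.\<close>

lemma
  fixes M :: "'i \<Rightarrow> 'a measure" and F :: "'l \<Rightarrow> ('i \<Rightarrow> 'a) \<Rightarrow> real"
  assumes I: "finite I" and M: "\<And>i. prob_space (M i)" and L: "finite L"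
    and K: "\<And>l. l \<in> L \<Longrightarrow> K l \<subseteq> I" "disjoint_family_on K L"
    and F [measurable]: "\<And>l. l \<in> L \<Longrightarrow> F l \<in> borel_measurable (PiM (K l) M)"
    and dep: "\<And>l \<omega>. l \<in> L \<Longrightarrow> F l (restrict \<omega> (K l)) = F l \<omega>"
    and int: "\<And>l. l \<in> L \<Longrightarrow> integrable (PiM I M) (F l)"
  shows integral_PiM_disjoint_prod:
      "(\<integral>\<omega>. (\<Prod>l\<in>L. F l \<omega>) \<partial>PiM I M) = (\<Prod>l\<in>L. \<integral>\<omega>. F l \<omega> \<partial>PiM I M)" (is ?A)
    and integrable_PiM_disjoint_prod: "integrable (PiM I M) (\<lambda>\<omega>. \<Prod>l\<in>L. F l \<omega>)" (is ?B)
proof -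
  interpret M: product_prob_space M I
    by (simp add: M product_prob_spaceI)
  have "M.indep_vars M (\<lambda>i \<omega>. \<omega> i) I" if "I \<noteq> {}"
  proof (subst M.indep_vars_iff_distr_eq_PiM'[OF that])
    have "distr (PiM I M) (PiM I M) (\<lambda>x. restrict x I) = distr (PiM I M) (PiM I M) (\<lambda>x. x)"
      by (intro distr_cong) (auto simp: space_PiM PiE_restrict)
    then show "distr (Pi\<^sub>M I M) (Pi\<^sub>M I M) (\<lambda>x. \<lambda>i\<in>I. x i) = (\<Pi>\<^sub>M i\<in>I. distr (Pi\<^sub>M I M) (M i) (\<lambda>\<omega>. \<omega> i))"
      by (simp add: M.PiM_component cong: PiM_cong)
  qed auto
  \<comment> \<open>The characterisation of independence through the joint law asks for a nonempty
    index set.\<close>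
  moreover have "M.indep_vars M (\<lambda>i \<omega>. \<omega> i) I" if "I = {}"
    using that unfolding M.indep_vars_def M.indep_sets_def by simp
  ultimately have "M.indep_vars M (\<lambda>i \<omega>. \<omega> i) I" by blast
  from M.indep_vars_restrict[OF this K]
  have "M.indep_vars (\<lambda>l. PiM (K l) M) (\<lambda>l \<omega>. restrict \<omega> (K l)) L"
    by simp
  from M.indep_vars_compose2[OF this, where Y = F and N = "\<lambda>_. borel"] F
  have "M.indep_vars (\<lambda>_. borel) (\<lambda>l \<omega>. F l (restrict \<omega> (K l))) L"
    by simp
  then have "M.indep_vars (\<lambda>_. borel) F L"
    by (subst (asm) M.indep_vars_cong[OF refl _ refl, where Y = F]) (auto simp: dep)
  from M.indep_vars_lebesgue_integral[OF L this int] M.indep_vars_integrable[OF L this int]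
  show ?A ?B by auto
qed

section \<open>Likelihood ratios and sign mixtures\<close>

text \<open>Weierstrass product inequality: it makes the affinity losses of independent columns add
  up.\<close>

lemma prod_one_minus_ge:
  fixes h :: "'a \<Rightarrow> real"
  assumes "finite A" "\<And>x. x \<in> A \<Longrightarrow> 0 \<le> h x" "\<And>x. x \<in> A \<Longrightarrow> h x \<le> 1"
  shows "(\<Prod>x\<in>A. 1 - h x) \<ge> 1 - (\<Sum>x\<in>A. h x)"
  using assms
proof (induction A rule: finite_induct)
  case (insert x A)
  let ?P = "\<Prod>x\<in>A. 1 - h x"
  have P: "?P \<le> 1" "?P \<ge> 1 - (\<Sum>x\<in>A. h x)"
    using insert by (auto intro!: prod_le_1)
  have "h x * ?P \<le> h x" using P insert by (intro mult_left_le) auto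
  then have "(1 - h x) * ?P \<ge> ?P - h x" by (simp add: algebra_simps)
  then show ?case using insert P by simp
qed simp

text \<open>For probability densities the left side integrates to the affinity minus 1/2, a lower
  bound on the testing error that is linear in the affinity. The inequality is the expansion of
  (sqrt x - sqrt y / 2)^2 \<ge> 0 for x the smaller number.\<close>

lemma min_ge_sqrt_mult:
  fixes a b :: real
  assumes "a \<ge> 0" "b \<ge> 0"
  shows "sqrt (a * b) - (a + b) / 4 \<le> min a b"
proof -
  have *: "sqrt (x * y) - (x + y) / 4 \<le> x" if "0 \<le> x" "x \<le> y" for x y :: real
  proof -
    have "0 \<le> (sqrt x - sqrt y / 2)\<^sup>2" by simp
    also have "\<dots> = x - sqrt (x * y) + y / 4"
      using that by (simp add: power2_eq_square algebra_simps real_sqrt_mult)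
    finally show ?thesis using that by argo
  qed
  show ?thesis
    using *[of a b] *[of b a] assms by (cases "a \<le> b") (auto simp: mult.commute add.commute)
qed

locale masked_noise =
  fixes I :: "'i set" and \<sigma> p :: real
  assumes fin_I: "finite I" and \<sigma>_pos: "\<sigma> > 0" and p_pos: "p > 0" and p_le: "p \<le> 1"
begin

abbreviation "NM \<equiv> (\<Pi>\<^sub>M _\<in>I. entry_law \<sigma> p)"

sublocale NM: product_prob_space "\<lambda>_::'i. entry_law \<sigma> p" I
  by (simp add: prob_space_entry_law \<sigma>_pos product_prob_spaceI)

text \<open>\<open>lr K a\<close> is the likelihood ratio of shifting the entries in \<open>K\<close> by \<open>a\<close>, and
  \<open>mix_lr K a\<close> the one for a shift by \<open>a\<close> or \<open>- a\<close> with a common fair random sign.\<close>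

definition lr :: "'i set \<Rightarrow> ('i \<Rightarrow> real) \<Rightarrow> ('i \<Rightarrow> real \<times> bool) \<Rightarrow> real" where
  "lr K a \<omega> = (\<Prod>x\<in>K. entry_lr \<sigma> (a x) (\<omega> x))"

definition mix_lr :: "'i set \<Rightarrow> ('i \<Rightarrow> real) \<Rightarrow> ('i \<Rightarrow> real \<times> bool) \<Rightarrow> real" where
  "mix_lr K a \<omega> = (lr K a \<omega> + lr K (- a) \<omega>) / 2"

text \<open>Squared odd part over even part: the integrand of the chi-square divergence of the shift
  by \<open>a\<close> from the fair mixture of both signs, which is triangular discrimination up to
  a factor.\<close>

definition sign_chi :: "'i set \<Rightarrow> ('i \<Rightarrow> real) \<Rightarrow> ('i \<Rightarrow> real \<times> bool) \<Rightarrow> real" where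
  "sign_chi K a \<omega> = ((lr K a \<omega> - lr K (- a) \<omega>) / 2)\<^sup>2 / mix_lr K a \<omega>"

lemma lr_pos: "lr K a \<omega> > 0"
  unfolding lr_def by (simp add: prod_pos entry_lr_pos)

lemma mix_lr_pos: "mix_lr K a \<omega> > 0"
  unfolding mix_lr_def by (simp add: add_pos_pos lr_pos)

lemma sign_chi_nonneg: "sign_chi K a \<omega> \<ge> 0"
  unfolding sign_chi_def by (simp add: less_imp_le[OF mix_lr_pos])

lemma entry_lr_component [measurable]:
  "x \<in> K \<Longrightarrow> (\<lambda>\<omega>. entry_lr \<sigma> c (\<omega> x)) \<in> borel_measurable (\<Pi>\<^sub>M _\<in>K. entry_law \<sigma> p)"
  by measurable

lemma lr_measurable [measurable]:
  "K \<subseteq> K' \<Longrightarrow> lr K a \<in> borel_measurable (\<Pi>\<^sub>M _\<in>K'. entry_law \<sigma> p)"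
  unfolding lr_def by (intro borel_measurable_prod entry_lr_component) auto

lemma mix_lr_measurable [measurable]:
  "K \<subseteq> K' \<Longrightarrow> mix_lr K a \<in> borel_measurable (\<Pi>\<^sub>M _\<in>K'. entry_law \<sigma> p)"
  unfolding mix_lr_def by measurable

lemma sign_chi_measurable [measurable]:
  "K \<subseteq> K' \<Longrightarrow> sign_chi K a \<in> borel_measurable (\<Pi>\<^sub>M _\<in>K'. entry_law \<sigma> p)"
  unfolding sign_chi_def by measurable

lemma lr_restrict: "K \<subseteq> K' \<Longrightarrow> lr K a (restrict \<omega> K') = lr K a \<omega>"
  unfolding lr_def by (intro prod.cong) auto

lemma mix_lr_restrict: "K \<subseteq> K' \<Longrightarrow> mix_lr K a (restrict \<omega> K') = mix_lr K a \<omega>"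
  unfolding mix_lr_def by (simp add: lr_restrict)

lemma sign_chi_restrict: "K \<subseteq> K' \<Longrightarrow> sign_chi K a (restrict \<omega> K') = sign_chi K a \<omega>"
  unfolding sign_chi_def by (simp add: lr_restrict mix_lr_restrict)

lemma lr_cong: "(\<And>x. x \<in> K \<Longrightarrow> a x = b x) \<Longrightarrow> lr K a = lr K b"
  unfolding lr_def by (auto intro!: prod.cong ext)

lemma mix_lr_cong: "(\<And>x. x \<in> K \<Longrightarrow> a x = b x) \<Longrightarrow> mix_lr K a = mix_lr K b"
  unfolding mix_lr_def by (auto simp: lr_cong[of K a b] lr_cong[of K "- a" "- b"] intro!: ext)

lemma lr_union: "finite K \<Longrightarrow> x \<notin> K \<Longrightarrow> lr (insert x K) a \<omega> = lr {x} a \<omega> * lr K a \<omega>"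
  unfolding lr_def by simp

text \<open>Change of measure: a shift of the noise becomes a weight, so that all hypotheses live
  under the single law \<open>NM\<close>.\<close>

lemma nn_integral_entry_shift:
  assumes [measurable]: "G \<in> borel_measurable NM"
  shows "(\<integral>\<^sup>+\<omega>. G (\<lambda>x\<in>I. entry_shift (a x) (\<omega> x)) \<partial>NM) = (\<integral>\<^sup>+\<omega>. ennreal (lr I a \<omega>) * G \<omega> \<partial>NM)"
proof -
  have T [measurable]: "(\<lambda>\<omega>. \<lambda>x\<in>I. entry_shift (a x) (\<omega> x)) \<in> NM \<rightarrow>\<^sub>M NM"
    by measurable
  have eq: "distr NM NM (\<lambda>\<omega>. \<lambda>x\<in>I. entry_shift (a x) (\<omega> x)) =
      density NM (\<lambda>\<omega>. \<Prod>x\<in>I. ennreal (entry_lr \<sigma> (a x) (\<omega> x)))"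
    by (rule distr_PiM_pointwise) (auto simp: fin_I \<sigma>_pos prob_space_entry_law distr_entry_shift)
  have "(\<integral>\<^sup>+\<omega>. G (\<lambda>x\<in>I. entry_shift (a x) (\<omega> x)) \<partial>NM) =
      (\<integral>\<^sup>+\<omega>. G \<omega> \<partial>distr NM NM (\<lambda>\<omega>. \<lambda>x\<in>I. entry_shift (a x) (\<omega> x)))"
    by (subst nn_integral_distr) auto
  also have "\<dots> = (\<integral>\<^sup>+\<omega>. ennreal (lr I a \<omega>) * G \<omega> \<partial>NM)"
    unfolding eq
    by (subst nn_integral_density)
       (auto simp: lr_def prod_ennreal less_imp_le[OF entry_lr_pos]
             intro!: borel_measurable_prod_ennreal measurable_compose[OF _ measurable_ennreal])
  finally show ?thesis .
qed

lemma lr_extend: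
  assumes "K \<subseteq> I"
  shows "lr I (\<lambda>x. if x \<in> K then a x else 0) = lr K a"
proof
  fix \<omega>
  have "lr I (\<lambda>x. if x \<in> K then a x else 0) \<omega> = (\<Prod>x\<in>I. if x \<in> K then entry_lr \<sigma> (a x) (\<omega> x) else 1)"
    unfolding lr_def by (intro prod.cong) auto
  also have "\<dots> = lr K a \<omega>"
    unfolding lr_def using assms fin_I by (simp add: prod.If_cases Int_absorb1)
  finally show "lr I (\<lambda>x. if x \<in> K then a x else 0) \<omega> = lr K a \<omega>" .
qed

lemma
  assumes K: "K \<subseteq> I"
  shows lr_integrable: "integrable NM (lr K a)" and lr_integral: "(\<integral>\<omega>. lr K a \<omega> \<partial>NM) = 1"
proof -
  have "(\<integral>\<^sup>+\<omega>. ennreal (lr K a \<omega>) \<partial>NM) = 1"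
    \<comment> \<open>The constant integrand 1 shows that the weight has total mass 1; a zero shift
      outside \<open>K\<close> reduces the full ratio to \<open>lr K a\<close>.\<close>
    using nn_integral_entry_shift[of "\<lambda>_. 1" "\<lambda>x. if x \<in> K then a x else 0"]
    by (simp add: lr_extend K NM.P.emeasure_space_1)
  then have "has_bochner_integral NM (lr K a) 1"
    using K by (intro has_bochner_integral_nn_integral) (auto simp: less_imp_le[OF lr_pos])
  then show "integrable NM (lr K a)" "(\<integral>\<omega>. lr K a \<omega> \<partial>NM) = 1"
    by (auto simp: has_bochner_integral_iff)
qed

lemma
  assumes K: "K \<subseteq> I"
  shows mix_lr_integrable: "integrable NM (mix_lr K a)"
    and mix_lr_integral: "(\<integral>\<omega>. mix_lr K a \<omega> \<partial>NM) = 1"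
  unfolding mix_lr_def using lr_integrable[OF K] lr_integral[OF K] by auto

lemma sign_chi_le_mix_lr: "sign_chi K a \<omega> \<le> mix_lr K a \<omega>"
proof -
  have "((lr K a \<omega> - lr K (- a) \<omega>) / 2)\<^sup>2 \<le> (mix_lr K a \<omega>)\<^sup>2"
    using lr_pos[of K a \<omega>] lr_pos[of K "- a" \<omega>] unfolding mix_lr_def
    by (intro abs_le_square_iff[THEN iffD1]) auto
  then show ?thesis
    using mix_lr_pos[of K a \<omega>] by (simp add: sign_chi_def divide_le_eq power2_eq_square)
qed

lemma
  assumes K: "K \<subseteq> I"
  shows sign_chi_integrable: "integrable NM (sign_chi K a)"
    and sign_chi_integral_le_1: "(\<integral>\<omega>. sign_chi K a \<omega> \<partial>NM) \<le> 1"
proof -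
  show *: "integrable NM (sign_chi K a)"
    by (rule Bochner_Integration.integrable_bound[OF mix_lr_integrable[OF K]])
       (use K in \<open>auto simp: sign_chi_nonneg less_imp_le[OF mix_lr_pos] intro!: sign_chi_le_mix_lr\<close>)
  show "(\<integral>\<omega>. sign_chi K a \<omega> \<partial>NM) \<le> 1"
    using integral_mono[OF * mix_lr_integrable[OF K] sign_chi_le_mix_lr] mix_lr_integral[OF K] by simp
qed

text \<open>With A and G the arithmetic and geometric means of the two ratios, the squared odd part
  is (A - G)(A + G) \<le> 2 A (A - G), so the quotient is at most 2 (A - G). Here G is exp (- t / 2)
  with t read off the mask, and A integrates to 1, so the expectation is at most that of t. No
  exponential moment appears, hence no restriction on the signal strength.\<close>

lemma sign_chi_pointwise:
  assumes K: "K \<subseteq> I"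
  shows "sign_chi K a \<omega> \<le> 2 * mix_lr K a \<omega> - 2 + (\<Sum>x\<in>K. of_bool (snd (\<omega> x)) * (a x)\<^sup>2 / \<sigma>\<^sup>2)"
proof -
  let ?x = "lr K a \<omega>" and ?y = "lr K (- a) \<omega>" and ?z = "sqrt (lr K a \<omega> * lr K (- a) \<omega>)"
  define t where "t = (\<Sum>x\<in>K. of_bool (snd (\<omega> x)) * (a x)\<^sup>2 / \<sigma>\<^sup>2)"
  have finK: "finite K" using K fin_I finite_subset by blast
  have "?x * ?y = (\<Prod>x\<in>K. exp (- (of_bool (snd (\<omega> x)) * (a x)\<^sup>2 / \<sigma>\<^sup>2)))"
    unfolding lr_def by (simp add: entry_lr_mult_neg flip: prod.distrib)
  also have "\<dots> = exp (- t)"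
    by (simp add: t_def sum_negf flip: exp_sum[OF finK])
  also have "\<dots> = (exp (- t / 2))\<^sup>2"
    by (simp add: power2_eq_square flip: exp_add)
  finally have "?z = exp (- t / 2)" by simp
  also have "\<dots> \<ge> 1 - t / 2" using exp_ge_add_one_self[of "- t / 2"] by simp
  finally have z: "?z \<ge> 1 - t / 2" .
  have xy: "?x > 0" "?y > 0" by (auto simp: lr_pos)
  have s: "sqrt ?x ^ 2 = ?x" "sqrt ?y ^ 2 = ?y" "?z = sqrt ?x * sqrt ?y"
    using xy by (auto simp: real_sqrt_mult)
  have am: "2 * ?z \<le> ?x + ?y"
    using sum_squares_ge_zero[of "sqrt ?x - sqrt ?y" 0] s by (simp add: power2_eq_square algebra_simps)
  have zz: "?z * ?z = ?x * ?y" using xy by simp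
  have "((?x - ?y) / 2)\<^sup>2 = ((?x + ?y) / 2 - ?z) * ((?x + ?y) / 2 + ?z)"
    using zz by (simp add: power2_eq_square algebra_simps) argo
  also have "\<dots> \<le> (?x + ?y - 2 * ?z) * ((?x + ?y) / 2)"
  proof -
    have "((?x + ?y) / 2 - ?z) * ((?x + ?y) / 2 + ?z) \<le> ((?x + ?y) / 2 - ?z) * (?x + ?y)"
      using am by (intro mult_left_mono) argo+
    then show ?thesis by (simp add: algebra_simps add_divide_distrib)
  qed
  finally have "sign_chi K a \<omega> \<le> ?x + ?y - 2 * ?z"
    unfolding sign_chi_def mix_lr_def using xy by (subst pos_divide_le_eq) auto
  also have "\<dots> \<le> 2 * mix_lr K a \<omega> - 2 + t"
    using z unfolding mix_lr_def by argo
  finally show ?thesis by (simp add: t_def)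
qed

lemma
  assumes x: "x \<in> I"
  shows mask_integrable: "integrable NM (\<lambda>\<omega>. of_bool (snd (\<omega> x)) :: real)"
    and mask_integral: "(\<integral>\<omega>. of_bool (snd (\<omega> x)) \<partial>NM) = p"
proof -
  let ?f = "\<lambda>y::real \<times> bool. of_bool (snd y) :: real"
  have [measurable]: "?f \<in> borel_measurable (borel \<Otimes>\<^sub>M count_space UNIV)" by measurable
  interpret N: prob_space "density lborel (normal_density 0 \<sigma>)" using \<sigma>_pos by (rule prob_space_normal_density)
  interpret B: prob_space "measure_pmf (bernoulli_pmf p)" by (rule prob_space_measure_pmf)
  interpret P: pair_prob_space "density lborel (normal_density 0 \<sigma>)" "measure_pmf (bernoulli_pmf p)" ..
  have m: "(\<lambda>\<omega>. \<omega> x) \<in> NM \<rightarrow>\<^sub>M entry_law \<sigma> p" using x by measurable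
  have d: "distr NM (entry_law \<sigma> p) (\<lambda>\<omega>. \<omega> x) = entry_law \<sigma> p"
    using NM.PiM_component[OF x] by simp
  have fm: "?f \<in> borel_measurable (entry_law \<sigma> p)" by measurable
  have i: "integrable (entry_law \<sigma> p) ?f"
    by (rule finite_measure.integrable_const_bound[of _ _ 1, OF prob_space.finite_measure[OF prob_space_entry_law[OF \<sigma>_pos]]]) (auto simp: fm)
  have "(\<integral>y. ?f y \<partial>entry_law \<sigma> p) = (\<integral>b. (\<integral>z. ?f (z, b) \<partial>density lborel (normal_density 0 \<sigma>)) \<partial>measure_pmf (bernoulli_pmf p))"
    using i P.integral_snd[of "\<lambda>_ b. of_bool b :: real"] unfolding entry_law_def by (simp add: case_prod_beta')
  also have "\<dots> = p"
    using p_pos p_le N.prob_space by (simp)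
  finally have "(\<integral>y. ?f y \<partial>entry_law \<sigma> p) = p" .
  then show "(\<integral>\<omega>. of_bool (snd (\<omega> x)) \<partial>NM) = p"
    using integral_distr[OF m fm] d by simp
  show "integrable NM (\<lambda>\<omega>. of_bool (snd (\<omega> x)) :: real)"
    using integrable_distr_eq[OF m fm] d i by simp
qed

lemma sign_chi_integral_le:
  assumes K: "K \<subseteq> I"
  shows "(\<integral>\<omega>. sign_chi K a \<omega> \<partial>NM) \<le> p * (\<Sum>x\<in>K. (a x)\<^sup>2) / \<sigma>\<^sup>2"
proof -
  have int: "integrable NM (\<lambda>\<omega>. of_bool (snd (\<omega> x)) * (a x)\<^sup>2 / \<sigma>\<^sup>2)" if "x \<in> K" for x
    using mask_integrable that K by auto
  have "(\<integral>\<omega>. sign_chi K a \<omega> \<partial>NM) \<le>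
      (\<integral>\<omega>. 2 * mix_lr K a \<omega> - 2 + (\<Sum>x\<in>K. of_bool (snd (\<omega> x)) * (a x)\<^sup>2 / \<sigma>\<^sup>2) \<partial>NM)"
    by (intro integral_mono sign_chi_integrable K sign_chi_pointwise)
       (use int mix_lr_integrable[OF K] in \<open>auto intro!: Bochner_Integration.integrable_add integrable_sum integrable_diff\<close>)
  also have "\<dots> = (\<Sum>x\<in>K. p * (a x)\<^sup>2 / \<sigma>\<^sup>2)"
    using int mix_lr_integrable[OF K] mix_lr_integral[OF K] K NM.P.prob_space
    by (subst Bochner_Integration.integral_add Bochner_Integration.integral_sum Bochner_Integration.integral_diff;
        auto simp: mask_integral subset_iff intro!: integrable_sum sum.cong)+
  finally show ?thesis by (simp add: sum_distrib_left sum_divide_distrib)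
qed

end

section \<open>Assouad's lemma and affinities\<close>

definition flip :: "'a \<Rightarrow> 'a set \<Rightarrow> 'a set" where
  "flip i \<theta> = (if i \<in> \<theta> then \<theta> - {i} else insert i \<theta>)"

lemma mem_flip_iff: "j \<in> flip i \<theta> \<longleftrightarrow> (if j = i then j \<notin> \<theta> else j \<in> \<theta>)"
  by (auto simp: flip_def)

lemma bij_betw_flip: "i \<in> S \<Longrightarrow> bij_betw (flip i) (Pow S) (Pow S)"
  by (rule bij_betw_byWitness[where f' = "flip i"]) (auto simp: flip_def)

text \<open>At every outcome coordinate i is decoded wrongly under exactly one of \<theta> and
  \<open>flip i \<theta>\<close>, so the two errors together are at least the minimum of the two
  likelihoods. The affinity bound 3/4 turns this into 1/4 per pair.\<close>

lemma assouad:
  fixes lik :: "'k set \<Rightarrow> 'w \<Rightarrow> real" and dec :: "'k \<Rightarrow> 'w \<Rightarrow> bool"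
  assumes S: "finite S"
    and nonneg: "\<And>\<theta> \<omega>. lik \<theta> \<omega> \<ge> 0"
    and int: "\<And>\<theta>. \<theta> \<subseteq> S \<Longrightarrow> integrable M (lik \<theta>)"
    and one: "\<And>\<theta>. \<theta> \<subseteq> S \<Longrightarrow> (\<integral>\<omega>. lik \<theta> \<omega> \<partial>M) = 1"
    and aff: "\<And>\<theta> i. \<theta> \<subseteq> S \<Longrightarrow> i \<in> S \<Longrightarrow> (\<integral>\<omega>. sqrt (lik \<theta> \<omega> * lik (flip i \<theta>) \<omega>) \<partial>M) \<ge> 3 / 4"
    and dec [measurable]: "\<And>i. i \<in> S \<Longrightarrow> Measurable.pred M (dec i)"
  shows "(\<Sum>\<theta>\<in>Pow S. \<integral>\<^sup>+\<omega>. ennreal (lik \<theta> \<omega>) * ennreal (\<Sum>i\<in>S. of_bool (dec i \<omega> \<noteq> (i \<in> \<theta>))) \<partial>M)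
     \<ge> ennreal (2 ^ card S * real (card S) / 8)"
proof -
  let ?e = "\<lambda>i \<theta> \<omega>. lik \<theta> \<omega> * of_bool (dec i \<omega> \<noteq> (i \<in> \<theta>)) :: real"
  have int_e: "integrable M (?e i \<theta>)" if "i \<in> S" "\<theta> \<subseteq> S" for i \<theta>
  proof -
    have [measurable]: "lik \<theta> \<in> borel_measurable M" using int that by blast
    show ?thesis
      by (rule Bochner_Integration.integrable_bound[OF int[OF that(2)]])
         (use that nonneg in \<open>auto simp: mult_left_le\<close>)
  qed
  have pair: "(\<integral>\<omega>. ?e i \<theta> \<omega> \<partial>M) + (\<integral>\<omega>. ?e i (flip i \<theta>) \<omega> \<partial>M) \<ge> 1 / 4"
    if i: "i \<in> S" and \<theta>: "\<theta> \<subseteq> S" for i \<theta>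
  proof -
    let ?P = "lik \<theta>" and ?Q = "lik (flip i \<theta>)"
    have \<theta>': "flip i \<theta> \<subseteq> S" using i \<theta> by (auto simp: flip_def)
    note [measurable] = borel_measurable_integrable[OF int[OF \<theta>]] borel_measurable_integrable[OF int[OF \<theta>']]
    have sq: "integrable M (\<lambda>\<omega>. sqrt (?P \<omega> * ?Q \<omega>))"
      by (rule Bochner_Integration.integrable_bound[OF Bochner_Integration.integrable_add[OF int[OF \<theta>] int[OF \<theta>']]])
         (use nonneg arith_geo_mean_sqrt in \<open>auto simp: add_nonneg_nonneg intro!: order_trans[OF arith_geo_mean_sqrt]\<close>)
    have "3 / 4 - (1 + 1) / 4 \<le> (\<integral>\<omega>. sqrt (?P \<omega> * ?Q \<omega>) \<partial>M) - ((\<integral>\<omega>. ?P \<omega> \<partial>M) + (\<integral>\<omega>. ?Q \<omega> \<partial>M)) / 4"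
      using aff[OF \<theta> i] one[OF \<theta>] one[OF \<theta>'] by simp
    also have "\<dots> = (\<integral>\<omega>. sqrt (?P \<omega> * ?Q \<omega>) - (?P \<omega> + ?Q \<omega>) / 4 \<partial>M)"
      using sq int[OF \<theta>] int[OF \<theta>'] by simp
    also have "\<dots> \<le> (\<integral>\<omega>. ?e i \<theta> \<omega> + ?e i (flip i \<theta>) \<omega> \<partial>M)"
    proof (rule integral_mono)
      fix \<omega>
      have "sqrt (?P \<omega> * ?Q \<omega>) - (?P \<omega> + ?Q \<omega>) / 4 \<le> min (?P \<omega>) (?Q \<omega>)"
        using nonneg by (intro min_ge_sqrt_mult)
      also have "\<dots> \<le> ?e i \<theta> \<omega> + ?e i (flip i \<theta>) \<omega>"
        by (auto simp: mem_flip_iff)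
      finally show "sqrt (?P \<omega> * ?Q \<omega>) - (?P \<omega> + ?Q \<omega>) / 4 \<le> ?e i \<theta> \<omega> + ?e i (flip i \<theta>) \<omega>" .
    qed (use sq int[OF \<theta>] int[OF \<theta>'] int_e[OF i \<theta>] int_e[OF i \<theta>'] in auto)
    finally show ?thesis
      using int_e[OF i \<theta>] int_e[OF i \<theta>'] by simp
  qed
  have coord: "(\<Sum>\<theta>\<in>Pow S. \<integral>\<omega>. ?e i \<theta> \<omega> \<partial>M) \<ge> 2 ^ card S / 8" if i: "i \<in> S" for i
  proof -
    \<comment> \<open>Flipping coordinate i permutes the cube, so the sum over \<theta> is half the
      sum over pairs: 1/4 becomes 1/8.\<close>
    have "(\<Sum>\<theta>\<in>Pow S. \<integral>\<omega>. ?e i \<theta> \<omega> \<partial>M) = (\<Sum>\<theta>\<in>Pow S. \<integral>\<omega>. ?e i (flip i \<theta>) \<omega> \<partial>M)"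
      by (rule sum.reindex_bij_betw[OF bij_betw_flip[OF i], symmetric])
    then have "2 * (\<Sum>\<theta>\<in>Pow S. \<integral>\<omega>. ?e i \<theta> \<omega> \<partial>M) =
        (\<Sum>\<theta>\<in>Pow S. (\<integral>\<omega>. ?e i \<theta> \<omega> \<partial>M) + (\<integral>\<omega>. ?e i (flip i \<theta>) \<omega> \<partial>M))"
      by (simp add: sum.distrib)
    also have "\<dots> \<ge> (\<Sum>\<theta>\<in>Pow S. 1 / 4)"
      by (intro sum_mono pair i) auto
    finally show ?thesis using S by (simp add: card_Pow)
  qed
  have "2 ^ card S * real (card S) / 8 = (\<Sum>i\<in>S. 2 ^ card S / 8)" by simp
  also have "\<dots> \<le> (\<Sum>i\<in>S. \<Sum>\<theta>\<in>Pow S. \<integral>\<omega>. ?e i \<theta> \<omega> \<partial>M)"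
    by (intro sum_mono coord)
  also have "\<dots> = (\<Sum>\<theta>\<in>Pow S. \<Sum>i\<in>S. \<integral>\<omega>. ?e i \<theta> \<omega> \<partial>M)" by (rule sum.swap)
  finally have "ennreal (2 ^ card S * real (card S) / 8) \<le> ennreal (\<Sum>\<theta>\<in>Pow S. \<Sum>i\<in>S. \<integral>\<omega>. ?e i \<theta> \<omega> \<partial>M)"
    by (rule ennreal_leI)
  also have "\<dots> = (\<Sum>\<theta>\<in>Pow S. ennreal (\<Sum>i\<in>S. \<integral>\<omega>. ?e i \<theta> \<omega> \<partial>M))"
    by (rule sum_ennreal[symmetric]) (auto intro!: sum_nonneg Bochner_Integration.integral_nonneg simp: nonneg)
  also have "\<dots> = (\<Sum>\<theta>\<in>Pow S. \<integral>\<^sup>+\<omega>. ennreal (lik \<theta> \<omega>) * ennreal (\<Sum>i\<in>S. of_bool (dec i \<omega> \<noteq> (i \<in> \<theta>))) \<partial>M)"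
  proof (rule sum.cong[OF refl])
    fix \<theta> assume "\<theta> \<in> Pow S"
    then have ie: "\<And>i. i \<in> S \<Longrightarrow> integrable M (?e i \<theta>)" using int_e by blast
    have "ennreal (\<Sum>i\<in>S. \<integral>\<omega>. ?e i \<theta> \<omega> \<partial>M) = ennreal (\<integral>\<omega>. (\<Sum>i\<in>S. ?e i \<theta> \<omega>) \<partial>M)"
      by (subst Bochner_Integration.integral_sum) (use ie in auto)
    also have "\<dots> = (\<integral>\<^sup>+\<omega>. ennreal (\<Sum>i\<in>S. ?e i \<theta> \<omega>) \<partial>M)"
      by (rule nn_integral_eq_integral[symmetric]) (use ie nonneg in \<open>auto intro!: sum_nonneg integrable_sum\<close>)
    also have "\<dots> = (\<integral>\<^sup>+\<omega>. ennreal (lik \<theta> \<omega>) * ennreal (\<Sum>i\<in>S. of_bool (dec i \<omega> \<noteq> (i \<in> \<theta>))) \<partial>M)"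
      by (intro nn_integral_cong) (simp add: nonneg sum_nonneg flip: ennreal_mult sum_distrib_left)
    finally show "ennreal (\<Sum>i\<in>S. \<integral>\<omega>. ?e i \<theta> \<omega> \<partial>M) =
       (\<integral>\<^sup>+\<omega>. ennreal (lik \<theta> \<omega>) * ennreal (\<Sum>i\<in>S. of_bool (dec i \<omega> \<noteq> (i \<in> \<theta>))) \<partial>M)" .
  qed
  finally show ?thesis .
qed

text \<open>The correction B^2 / A is chosen because it is multiplicative: if A and B factor over
  independent groups of entries, so does the loss of affinity.\<close>

lemma sqrt_sum_diff_ge:
  fixes A B :: real
  assumes "\<bar>B\<bar> \<le> A" "A > 0"
  shows "sqrt ((A + B) * (A - B)) \<ge> A - B\<^sup>2 / A"
proof (rule real_le_rsqrt)
  have B: "B\<^sup>2 \<le> A\<^sup>2" using assms by (simp add: abs_le_square_iff[symmetric])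
  have "(A - B\<^sup>2 / A)\<^sup>2 = A\<^sup>2 - 2 * B\<^sup>2 + B\<^sup>2 * (B\<^sup>2 / A\<^sup>2)"
    using assms by (simp add: field_simps power2_eq_square)
  also have "B\<^sup>2 * (B\<^sup>2 / A\<^sup>2) \<le> B\<^sup>2 * 1"
    using assms B by (intro mult_left_mono) auto
  finally show "(A - B\<^sup>2 / A)\<^sup>2 \<le> (A + B) * (A - B)"
    by (simp add: algebra_simps power2_eq_square)
qed

section \<open>Affinities of sign mixtures over independent columns\<close>

context masked_noise
begin

lemma
  assumes K: "K1 \<subseteq> I" "K2 \<subseteq> I" "K1 \<inter> K2 = {}"
    and F: "F \<in> borel_measurable (\<Pi>\<^sub>M _\<in>K1. entry_law \<sigma> p)" "\<And>\<omega>. F (restrict \<omega> K1) = F \<omega>" "integrable NM F"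
    and G: "G \<in> borel_measurable (\<Pi>\<^sub>M _\<in>K2. entry_law \<sigma> p)" "\<And>\<omega>. G (restrict \<omega> K2) = G \<omega>" "integrable NM G"
  shows integral_disjoint_mult: "(\<integral>\<omega>. F \<omega> * G \<omega> \<partial>NM) = (\<integral>\<omega>. F \<omega> \<partial>NM) * (\<integral>\<omega>. G \<omega> \<partial>NM)"
    and integrable_disjoint_mult: "integrable NM (\<lambda>\<omega>. F \<omega> * G \<omega> :: real)"
proof -
  let ?K = "\<lambda>b. if b then K1 else K2" and ?F = "\<lambda>b. if b then F else G"
  have "disjoint_family_on ?K UNIV" using K by (auto simp: disjoint_family_on_def)
  with K F G have
    "(\<integral>\<omega>. (\<Prod>l\<in>UNIV. ?F l \<omega>) \<partial>NM) = (\<Prod>l\<in>UNIV. \<integral>\<omega>. ?F l \<omega> \<partial>NM)"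
    "integrable NM (\<lambda>\<omega>. \<Prod>l\<in>UNIV. ?F l \<omega>)"
    by (intro integral_PiM_disjoint_prod[where K = ?K] integrable_PiM_disjoint_prod[where K = ?K];
        auto simp: fin_I prob_space_entry_law \<sigma>_pos split: if_splits)+
  then show "(\<integral>\<omega>. F \<omega> * G \<omega> \<partial>NM) = (\<integral>\<omega>. F \<omega> \<partial>NM) * (\<integral>\<omega>. G \<omega> \<partial>NM)"
    "integrable NM (\<lambda>\<omega>. F \<omega> * G \<omega> :: real)"
    by (simp_all add: UNIV_bool mult.commute)
qed

lemma sqrt_mix_lr_integrable:
  assumes "K \<subseteq> I"
  shows "integrable NM (\<lambda>\<omega>. sqrt (mix_lr K a \<omega> * mix_lr K b \<omega>))"
proof -
  note [measurable] = mix_lr_measurable[OF assms]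
  show ?thesis
    by (rule Bochner_Integration.integrable_bound[OF Bochner_Integration.integrable_add[OF
          mix_lr_integrable[OF assms, of a] mix_lr_integrable[OF assms, of b]]])
       (use less_imp_le[OF mix_lr_pos] in
         \<open>auto simp: add_nonneg_nonneg intro!: order_trans[OF arith_geo_mean_sqrt]\<close>)
qed

text \<open>Flipping one coordinate of a shift that carries a random overall sign is seen only through
  the product of the two sign statistics; this product is what yields the quadratic rate.\<close>

lemma mix_lr_affinity:
  assumes K: "K \<subseteq> I" and x: "x \<in> K"
  shows "(\<integral>\<omega>. sqrt (mix_lr K a \<omega> * mix_lr K (a(x := - a x)) \<omega>) \<partial>NM) \<ge>
     1 - (\<integral>\<omega>. sign_chi (K - {x}) a \<omega> \<partial>NM) * (\<integral>\<omega>. sign_chi {x} a \<omega> \<partial>NM)"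
proof -
  let ?K = "K - {x}" and ?a' = "a(x := - a x)"
  have finK: "finite ?K" using K fin_I finite_subset by blast
  have K': "?K \<subseteq> I" "{x} \<subseteq> I" "?K \<inter> {x} = {}" using K x by auto
  have pw: "mix_lr ?K a \<omega> * mix_lr {x} a \<omega> - sign_chi ?K a \<omega> * sign_chi {x} a \<omega>
      \<le> sqrt (mix_lr K a \<omega> * mix_lr K ?a' \<omega>)" for \<omega>
  proof -
    let ?f = "lr ?K a \<omega>" and ?f' = "lr ?K (- a) \<omega>" and ?g = "lr {x} a \<omega>" and ?g' = "lr {x} (- a) \<omega>"
    have ins: "lr K b \<omega> = lr {x} b \<omega> * lr ?K b \<omega>" for b
      using lr_union[OF finK, of x b \<omega>] x by (simp add: insert_absorb)
    \<comment> \<open>Changing the sign at x leaves the rest of the block alone and exchanges the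
      two ratios of the entry x.\<close>
    have flips: "lr ?K ?a' \<omega> = ?f" "lr ?K (- ?a') \<omega> = ?f'" "lr {x} ?a' \<omega> = ?g'" "lr {x} (- ?a') \<omega> = ?g"
      by (auto simp: lr_def intro!: prod.cong)
    \<comment> \<open>A is the product of the even parts of the rest and of the entry, B the product
      of their odd parts. The mixtures before and after the flip are A + B and A - B.\<close>
    define A where "A = mix_lr ?K a \<omega> * mix_lr {x} a \<omega>"
    define B where "B = (?f - ?f') / 2 * ((?g - ?g') / 2)"
    have AB: "A + B = mix_lr K a \<omega>" "A - B = mix_lr K ?a' \<omega>"
      unfolding A_def B_def by (simp_all add: mix_lr_def ins flips field_simps)
    have "\<bar>B\<bar> \<le> A" using AB mix_lr_pos[of K a \<omega>] mix_lr_pos[of K ?a' \<omega>] by linarith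
    moreover have "A > 0" unfolding A_def by (simp add: mix_lr_pos)
    ultimately have "sqrt ((A + B) * (A - B)) \<ge> A - B\<^sup>2 / A" by (rule sqrt_sum_diff_ge)
    also have "B\<^sup>2 / A = sign_chi ?K a \<omega> * sign_chi {x} a \<omega>"
      unfolding A_def B_def sign_chi_def
      by (subst power_mult_distrib) (rule times_divide_times_eq[symmetric])
    finally show ?thesis unfolding AB by (simp add: A_def)
  qed
  note mix = integral_disjoint_mult[OF K', of "mix_lr ?K a" "mix_lr {x} a"]
    integrable_disjoint_mult[OF K', of "mix_lr ?K a" "mix_lr {x} a"]
  note chi = integral_disjoint_mult[OF K', of "sign_chi ?K a" "sign_chi {x} a"]
    integrable_disjoint_mult[OF K', of "sign_chi ?K a" "sign_chi {x} a"]
  have m: "(\<integral>\<omega>. mix_lr ?K a \<omega> * mix_lr {x} a \<omega> \<partial>NM) = 1" "integrable NM (\<lambda>\<omega>. mix_lr ?K a \<omega> * mix_lr {x} a \<omega>)"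
    using mix K' by (simp_all add: mix_lr_measurable mix_lr_restrict mix_lr_integrable mix_lr_integral)
  have c: "(\<integral>\<omega>. sign_chi ?K a \<omega> * sign_chi {x} a \<omega> \<partial>NM) = (\<integral>\<omega>. sign_chi ?K a \<omega> \<partial>NM) * (\<integral>\<omega>. sign_chi {x} a \<omega> \<partial>NM)"
      "integrable NM (\<lambda>\<omega>. sign_chi ?K a \<omega> * sign_chi {x} a \<omega>)"
    using chi K' by (simp_all add: sign_chi_measurable sign_chi_restrict sign_chi_integrable)
  have "1 - (\<integral>\<omega>. sign_chi ?K a \<omega> \<partial>NM) * (\<integral>\<omega>. sign_chi {x} a \<omega> \<partial>NM) =
      (\<integral>\<omega>. mix_lr ?K a \<omega> * mix_lr {x} a \<omega> - sign_chi ?K a \<omega> * sign_chi {x} a \<omega> \<partial>NM)"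
    using m c by simp
  also have "\<dots> \<le> (\<integral>\<omega>. sqrt (mix_lr K a \<omega> * mix_lr K ?a' \<omega>) \<partial>NM)"
    by (intro integral_mono sqrt_mix_lr_integrable K pw) (use m c in auto)
  finally show ?thesis .
qed

lemma prod_mix_lr_affinity:
  fixes K :: "'j \<Rightarrow> 'i set"
  assumes J: "finite J" and K: "\<And>j. j \<in> J \<Longrightarrow> K j \<subseteq> I" "disjoint_family_on K J"
    and h: "\<And>j. j \<in> J \<Longrightarrow> (\<integral>\<omega>. sqrt (mix_lr (K j) a \<omega> * mix_lr (K j) b \<omega>) \<partial>NM) \<ge> 1 - h"
    and h01: "0 \<le> h" "h \<le> 1"
  shows "(\<integral>\<omega>. sqrt ((\<Prod>j\<in>J. mix_lr (K j) a \<omega>) * (\<Prod>j\<in>J. mix_lr (K j) b \<omega>)) \<partial>NM) \<ge> 1 - real (card J) * h"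
proof -
  have sq: "sqrt (\<Prod>j\<in>J. f j) = (\<Prod>j\<in>J. sqrt (f j))" for f :: "'j \<Rightarrow> real"
    by (induction J rule: infinite_finite_induct) (auto simp: real_sqrt_mult)
  have "1 - real (card J) * h \<le> (\<Prod>j\<in>J. 1 - h)"
    using prod_one_minus_ge[OF J, of "\<lambda>_. h"] h01 by simp
  also have "\<dots> \<le> (\<Prod>j\<in>J. \<integral>\<omega>. sqrt (mix_lr (K j) a \<omega> * mix_lr (K j) b \<omega>) \<partial>NM)"
    using h h01 by (intro prod_mono) auto
  also have "\<dots> = (\<integral>\<omega>. (\<Prod>j\<in>J. sqrt (mix_lr (K j) a \<omega> * mix_lr (K j) b \<omega>)) \<partial>NM)"
    by (rule integral_PiM_disjoint_prod[symmetric, where K = K])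
       (use J K in \<open>auto simp: fin_I prob_space_entry_law \<sigma>_pos mix_lr_measurable mix_lr_restrict
          sqrt_mix_lr_integrable intro!: borel_measurable_sqrt borel_measurable_times\<close>)
  also have "\<dots> = (\<integral>\<omega>. sqrt ((\<Prod>j\<in>J. mix_lr (K j) a \<omega>) * (\<Prod>j\<in>J. mix_lr (K j) b \<omega>)) \<partial>NM)"
    by (simp only: sq prod.distrib[symmetric])
  finally show ?thesis .
qed

lemma
  fixes K :: "'j \<Rightarrow> 'i set"
  assumes J: "finite J" and K: "\<And>j. j \<in> J \<Longrightarrow> K j \<subseteq> I" "disjoint_family_on K J"
  shows prod_mix_lr_integrable: "integrable NM (\<lambda>\<omega>. \<Prod>j\<in>J. mix_lr (K j) a \<omega>)"
    and prod_mix_lr_integral: "(\<integral>\<omega>. (\<Prod>j\<in>J. mix_lr (K j) a \<omega>) \<partial>NM) = 1"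
proof -
  note * = fin_I J K
  show "integrable NM (\<lambda>\<omega>. \<Prod>j\<in>J. mix_lr (K j) a \<omega>)"
    by (rule integrable_PiM_disjoint_prod[where K = K])
       (use * in \<open>auto simp: prob_space_entry_law \<sigma>_pos mix_lr_measurable mix_lr_restrict mix_lr_integrable\<close>)
  have "(\<integral>\<omega>. (\<Prod>j\<in>J. mix_lr (K j) a \<omega>) \<partial>NM) = (\<Prod>j\<in>J. \<integral>\<omega>. mix_lr (K j) a \<omega> \<partial>NM)"
    by (rule integral_PiM_disjoint_prod[where K = K])
       (use * in \<open>auto simp: prob_space_entry_law \<sigma>_pos mix_lr_measurable mix_lr_restrict mix_lr_integrable\<close>)
  then show "(\<integral>\<omega>. (\<Prod>j\<in>J. mix_lr (K j) a \<omega>) \<partial>NM) = 1" using K by (simp add: mix_lr_integral)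
qed

text \<open>Expanding the product of averages gives the uniform average over all joint sign
  patterns. This links the product form, good for affinities, with the actual hypotheses, one for
  each pattern.\<close>

lemma prod_mix_lr_eq_sum:
  fixes K :: "'j \<Rightarrow> 'i set"
  assumes J: "finite J" and K: "\<And>j. j \<in> J \<Longrightarrow> finite (K j)" "disjoint_family_on K J"
  shows "2 ^ card J * (\<Prod>j\<in>J. mix_lr (K j) a \<omega>) =
    (\<Sum>\<eta>\<in>Pow J. lr (\<Union>j\<in>J. K j) (\<lambda>x. if x \<in> (\<Union>j\<in>\<eta>. K j) then a x else - a x) \<omega>)"
proof -
  have "2 ^ card J * (\<Prod>j\<in>J. mix_lr (K j) a \<omega>) = (\<Prod>j\<in>J. lr (K j) a \<omega> + lr (K j) (- a) \<omega>)"
    by (simp add: mix_lr_def prod_dividef)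
  also have "\<dots> = (\<Sum>\<eta>\<in>Pow J. (\<Prod>j\<in>\<eta>. lr (K j) a \<omega>) * (\<Prod>j\<in>J-\<eta>. lr (K j) (- a) \<omega>))"
    by (rule prod_add[OF J])
  also have "\<dots> = (\<Sum>\<eta>\<in>Pow J. lr (\<Union>j\<in>J. K j) (\<lambda>x. if x \<in> (\<Union>j\<in>\<eta>. K j) then a x else - a x) \<omega>)"
  proof (rule sum.cong[OF refl])
    fix \<eta> assume "\<eta> \<in> Pow J"
    then have \<eta>: "\<eta> \<subseteq> J" by simp
    let ?b = "\<lambda>x. if x \<in> (\<Union>j\<in>\<eta>. K j) then a x else - a x"
    have mem: "x \<in> (\<Union>j\<in>\<eta>. K j) \<longleftrightarrow> j \<in> \<eta>" if "j \<in> J" "x \<in> K j" for x j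
    proof
      assume "x \<in> (\<Union>j\<in>\<eta>. K j)"
      then obtain k where "k \<in> \<eta>" "x \<in> K k" by blast
      then show "j \<in> \<eta>"
        using disjoint_family_onD[OF K(2), of j k] \<eta> that by (cases "j = k") auto
    qed (use that in blast)
    have "lr (\<Union>j\<in>J. K j) ?b \<omega> = (\<Prod>j\<in>J. lr (K j) ?b \<omega>)"
      unfolding lr_def using J K by (subst prod.UNION_disjoint) (auto simp: disjoint_family_on_def)
    also have "\<dots> = (\<Prod>j\<in>J. if j \<in> \<eta> then lr (K j) a \<omega> else lr (K j) (- a) \<omega>)"
      unfolding lr_def using mem by (intro prod.cong) (auto intro!: prod.cong)
    also have "\<dots> = (\<Prod>j\<in>\<eta>. lr (K j) a \<omega>) * (\<Prod>j\<in>J-\<eta>. lr (K j) (- a) \<omega>)"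
      using J \<eta> by (simp add: prod.If_cases Int_absorb1 Diff_eq)
    finally show "(\<Prod>j\<in>\<eta>. lr (K j) a \<omega>) * (\<Prod>j\<in>J-\<eta>. lr (K j) (- a) \<omega>) = lr (\<Union>j\<in>J. K j) ?b \<omega>" ..
  qed
  finally show ?thesis .
qed

end

section \<open>The family of hypotheses\<close>

text \<open>Column 0 carries w and column k \<ge> 1 is the unit vector at k, so w has to vanish on
  1, ..., r - 1. The same shape serves for both singular bases.\<close>

definition frame :: "nat \<Rightarrow> nat \<Rightarrow> (nat \<Rightarrow> real) \<Rightarrow> real mat" where
  "frame d r w = mat d r (\<lambda>(i,k). if k = 0 then w i else of_bool (i = k))"

lemma frame_carrier [simp]:
  "frame d r w \<in> carrier_mat d r" "dim_row (frame d r w) = d" "dim_col (frame d r w) = r"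
  by (simp_all add: frame_def)

lemma frame_orthonormal:
  assumes r: "r \<le> d" and zero: "\<And>i. 1 \<le> i \<Longrightarrow> i < r \<Longrightarrow> w i = 0" and one: "(\<Sum>i<d. (w i)\<^sup>2) = 1"
  shows "transpose_mat (frame d r w) * frame d r w = 1\<^sub>m r"
proof (rule eq_matI)
  fix k l assume "k < dim_row (1\<^sub>m r :: real mat)" "l < dim_col (1\<^sub>m r :: real mat)"
  then have kl: "k < r" "l < r" by auto
  let ?f = "\<lambda>i k. if k = 0 then w i else of_bool (i = k)"
  have "(transpose_mat (frame d r w) * frame d r w) $$ (k, l) = (\<Sum>i<d. ?f i k * ?f i l)"
    using kl by (simp add: frame_def scalar_prod_def lessThan_atLeast0)
  also have "\<dots> = of_bool (k = l)"
  proof (cases "k = 0")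
    case k: True
    show ?thesis
    proof (cases "l = 0")
      case True
      then show ?thesis using k one by (simp add: power2_eq_square)
    next
      case False
      then have "(\<Sum>i<d. ?f i k * ?f i l) = (\<Sum>i<d. if i = l then w i else 0)"
        using k by (intro sum.cong) auto
      then show ?thesis using False k kl zero[of l] r by simp
    qed
  next
    case k: False
    have "(\<Sum>i<d. ?f i k * ?f i l) = (\<Sum>i<d. if i = k then ?f k l else 0)"
      using k by (intro sum.cong) auto
    then show ?thesis using k kl zero[of k] r by simp
  qed
  finally show "(transpose_mat (frame d r w) * frame d r w) $$ (k, l) = 1\<^sub>m r $$ (k, l)"
    using kl by simp
qed simp_all

text \<open>The unit-vector columns vanish in row 0 and contribute nothing. Column 0 of the Gram
  matrix is therefore a multiple of w, and a large w 0 makes its signs readable.\<close>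

lemma frame_gram_column:
  assumes "0 < r" "i < d"
  shows "(frame d r w * transpose_mat (frame d r w)) $$ (i, 0) = w i * w 0"
proof -
  have "(frame d r w * transpose_mat (frame d r w)) $$ (i, 0) =
     (\<Sum>k<r. (if k = 0 then w i else of_bool (i = k)) * (if k = 0 then w 0 else of_bool (0 = k)))"
    using assms by (simp add: frame_def scalar_prod_def lessThan_atLeast0)
  also have "\<dots> = (\<Sum>k<r. if k = 0 then w i * w 0 else 0)"
    by (intro sum.cong) auto
  finally show ?thesis using assms by simp
qed

lemma frame_svd_entry:
  assumes "0 < r" "i < d1" "j < d2"
  shows "(frame d1 r u * diag_real r (\<lambda>_. c) * transpose_mat (frame d2 r v)) $$ (i, j) =
    c * u i * v j + c * of_bool (i = j \<and> 1 \<le> i \<and> i < r)"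
proof -
  let ?f = "\<lambda>w i k. if k = 0 then w i else of_bool (i = k)"
  have D: "(frame d1 r u * diag_real r (\<lambda>_. c)) $$ (i, k) = ?f u i k * c" if "k < r" for k
  proof -
    have "(frame d1 r u * diag_real r (\<lambda>_. c)) $$ (i, k) = (\<Sum>l<r. ?f u i l * (if l = k then c else 0))"
      using assms that by (simp add: frame_def diag_real_def scalar_prod_def lessThan_atLeast0)
    also have "\<dots> = (\<Sum>l<r. if l = k then ?f u i k * c else 0)"
      by (intro sum.cong) auto
    finally show ?thesis using that by simp
  qed
  have "(frame d1 r u * diag_real r (\<lambda>_. c) * transpose_mat (frame d2 r v)) $$ (i, j) =
     (\<Sum>k<r. (frame d1 r u * diag_real r (\<lambda>_. c)) $$ (i, k) * ?f v j k)"
    using assms by (simp add: scalar_prod_def lessThan_atLeast0 frame_def)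
  also have "\<dots> = (\<Sum>k<r. (if k = 0 then c * u i * v j else 0) + (if k = i then c * of_bool (i = j \<and> 1 \<le> i) else 0))"
    by (intro sum.cong) (auto simp: D)
  also have "\<dots> = c * u i * v j + c * of_bool (i = j \<and> 1 \<le> i \<and> i < r)"
    using assms by (simp add: sum.distrib)
  finally show ?thesis .
qed

text \<open>\<delta> is the Euclidean length of the sign part of u; \<delta> \<le> 1/2 keeps its
  first entry at least 1/2.\<close>

locale hypotheses =
  fixes d1 d2 r :: nat and \<sigma> ss p \<delta> :: real
  assumes r: "1 \<le> r" "r < d1" "r \<le> d2" and \<sigma>: "\<sigma> > 0" and ss: "ss > 0" and p: "p > 0" "p \<le> 1"
    and \<delta>: "0 < \<delta>" "\<delta> \<le> 1 / 2"
begin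

text \<open>Indices 1, ..., r - 1 belong to the fixed unit vectors. Row 0 carries the known large
  entry of u and is left out of \<open>S\<close>, whereas column 0 carries a random sign of v like
  the others, hence the extra 1 in n = d2 - r + 1.\<close>

definition "S = {r..<d1}"
definition "J = insert 0 {r..<d2}"

abbreviation "m \<equiv> card S"
abbreviation "n \<equiv> card J"

definition uvec :: "nat set \<Rightarrow> nat \<Rightarrow> real" where
  "uvec \<theta> i = (if i = 0 then sqrt (1 - \<delta>\<^sup>2) else if i \<in> S then (if i \<in> \<theta> then 1 else - 1) * (\<delta> / sqrt m) else 0)"

definition vvec :: "nat set \<Rightarrow> nat \<Rightarrow> real" where
  "vvec \<eta> j = (if j \<in> J then (if j \<in> \<eta> then 1 else - 1) / sqrt n else 0)"

definition signal :: "nat set \<Rightarrow> nat set \<Rightarrow> real mat" where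
  "signal \<theta> \<eta> = frame d1 r (uvec \<theta>) * diag_real r (\<lambda>_. ss) * transpose_mat (frame d2 r (vvec \<eta>))"

text \<open>The part of the signal shared by all hypotheses; everything else is treated as a shift
  of the noise.\<close>

definition base :: "real mat" where
  "base = mat d1 d2 (\<lambda>(i,j). ss * of_bool (i = j \<and> 1 \<le> i \<and> i < r))"

lemma m: "m = d1 - r" "m > 0" and n: "n = d2 - r + 1" "n > 0"
  using r by (auto simp: S_def J_def)

lemma finite_SJ [simp]: "finite S" "finite J" by (auto simp: S_def J_def)

lemma zero_notin_S [simp]: "0 \<notin> S" using r by (auto simp: S_def)

lemma \<delta>_sq: "\<delta>\<^sup>2 \<le> 1 / 4"
  using power_mono[of \<delta> "1 / 2" 2] \<delta> by (simp add: power2_eq_square)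

lemma uvec_sq: "(uvec \<theta> i)\<^sup>2 = (if i = 0 then 1 - \<delta>\<^sup>2 else if i \<in> S then \<delta>\<^sup>2 / m else 0)"
  using \<delta>_sq by (auto simp: uvec_def power_divide power_mult_distrib)

lemma sum_uvec_sq: "(\<Sum>i\<in>insert 0 S. (uvec \<theta> i)\<^sup>2) = 1"
proof -
  have "(\<Sum>i\<in>S. (uvec \<theta> i)\<^sup>2) = (\<Sum>i\<in>S. \<delta>\<^sup>2 / m)"
    by (intro sum.cong) (auto simp: uvec_sq)
  also have "\<dots> = \<delta>\<^sup>2" using m by simp
  finally show ?thesis by (simp add: uvec_sq)
qed

lemma compact_svd_signal:
  "compact_svd d1 d2 r (signal \<theta> \<eta>) (frame d1 r (uvec \<theta>)) (\<lambda>_. ss) (frame d2 r (vvec \<eta>))"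
proof -
  have "(\<Sum>i<d1. (uvec \<theta> i)\<^sup>2) = (\<Sum>i\<in>insert 0 S. (uvec \<theta> i)\<^sup>2)"
    using r by (intro sum.mono_neutral_right) (auto simp: S_def uvec_def)
  then have U: "transpose_mat (frame d1 r (uvec \<theta>)) * frame d1 r (uvec \<theta>) = 1\<^sub>m r"
    using r sum_uvec_sq[of \<theta>] by (intro frame_orthonormal) (auto simp: uvec_def S_def)
  have "(\<Sum>j<d2. (vvec \<eta> j)\<^sup>2) = (\<Sum>j\<in>J. (vvec \<eta> j)\<^sup>2)"
    using r by (intro sum.mono_neutral_right) (auto simp: J_def vvec_def)
  also have "\<dots> = (\<Sum>j\<in>J. 1 / n)"
    by (intro sum.cong) (auto simp: vvec_def power_divide)
  also have "\<dots> = 1" using n by simp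
  finally have V: "transpose_mat (frame d2 r (vvec \<eta>)) * frame d2 r (vvec \<eta>) = 1\<^sub>m r"
    using r by (intro frame_orthonormal) (auto simp: vvec_def J_def)
  show ?thesis
    unfolding compact_svd_diag_real using U V ss by (auto simp: signal_def)
qed

lemma signal_entry:
  "i < d1 \<Longrightarrow> j < d2 \<Longrightarrow> signal \<theta> \<eta> $$ (i, j) = ss * uvec \<theta> i * vvec \<eta> j + base $$ (i, j)"
  unfolding signal_def using r by (subst frame_svd_entry) (auto simp: base_def)

text \<open>The decoder takes the signs in column 0 of Uh Uh^T. Each wrong sign costs at least
  \<delta> / (2 sqrt m) in that column, while the whole column error is at most three times the
  loss. The factor \<kappa> lets one argument serve both norms.\<close>

lemma rot_loss_ge_hamming:
  assumes Uh: "Uh \<in> carrier_mat d1 r"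
    and nm: "\<And>E. E \<in> carrier_mat d1 r \<Longrightarrow> nm E \<ge> \<kappa> * spec_norm E" and \<kappa>: "\<kappa> \<ge> 0"
  shows "rot_loss nm r Uh (left_sv d1 d2 r (signal \<theta> \<eta>)) \<ge>
    \<kappa> * (\<delta> / (6 * m) * (\<Sum>i\<in>S. of_bool (((Uh * transpose_mat Uh) $$ (i, 0) > 0) \<noteq> (i \<in> \<theta>))))"
proof -
  let ?U = "left_sv d1 d2 r (signal \<theta> \<eta>)"
  let ?w = "\<lambda>i. (Uh * transpose_mat Uh) $$ (i, 0)"
  let ?D = "\<Sum>i\<in>S. of_bool ((?w i > 0) \<noteq> (i \<in> \<theta>)) :: real"
  have m': "real m > 0" using m by simp
  note L = left_sv_compact_svd[OF compact_svd_signal[of \<theta> \<eta>] r(1) ss]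
  have g: "(?U * transpose_mat ?U) $$ (i, 0) = uvec \<theta> i * sqrt (1 - \<delta>\<^sup>2)" if "i < d1" for i
    unfolding L(3) using that r by (subst frame_gram_column) (auto simp: uvec_def)
  have "1 / 4 \<le> 1 - \<delta>\<^sup>2" using \<delta>_sq by simp
  then have "sqrt (1 / 4) \<le> sqrt (1 - \<delta>\<^sup>2)" by (rule real_sqrt_le_mono)
  then have half: "1 / 2 \<le> sqrt (1 - \<delta>\<^sup>2)" by (simp add: real_sqrt_divide)
  have D_le: "?D \<le> m"
    using sum_mono[of S "\<lambda>i. of_bool ((?w i > 0) \<noteq> (i \<in> \<theta>)) :: real" "\<lambda>_. 1"] by simp
  have D_ge: "?D \<ge> 0" by (intro sum_nonneg) auto
  have bound: "\<delta> / (6 * m) * ?D \<le> spec_norm (Uh * R - ?U)" if R: "R \<in> orth_mats r" for R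
  proof (cases "spec_norm (Uh * R - ?U) \<le> 1")
    \<comment> \<open>A loss above 1 needs no decoding, because the claimed bound is at most
      \<delta> / 6.\<close>
    case False
    have "\<delta> / (6 * m) * ?D \<le> \<delta> / (6 * m) * m"
      using D_le \<delta> by (intro mult_left_mono) auto
    also have "\<dots> \<le> 1" using \<delta> m' by simp
    finally show ?thesis using False by linarith
  next
    case True
    have diag: "(?U * transpose_mat ?U) $$ (0, 0) \<le> 1"
      using r \<delta>_sq by (subst g) (auto simp: uvec_def)
    have wrong: "\<delta>\<^sup>2 / (4 * m) * of_bool ((?w i > 0) \<noteq> (i \<in> \<theta>)) \<le> (?w i - (?U * transpose_mat ?U) $$ (i, 0))\<^sup>2"
      if i: "i \<in> S" for i
    proof (cases "(?w i > 0) \<noteq> (i \<in> \<theta>)")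
      case w: True
      have i': "i < d1" "i \<noteq> 0" using i r by (auto simp: S_def)
      let ?b = "\<delta> / sqrt m * sqrt (1 - \<delta>\<^sup>2)"
      have b: "?b \<ge> \<delta> / sqrt m * (1 / 2)" using half \<delta> by (intro mult_left_mono) auto
      have b0: "\<delta> / sqrt m * (1 / 2) \<ge> 0" using \<delta> by simp
      \<comment> \<open>The target entry is \<open>?b\<close> or \<open>- ?b\<close>, and a wrongly
        decoded \<open>?w i\<close> lies on the other side of 0 or at 0.\<close>
      have "\<bar>?w i - (?U * transpose_mat ?U) $$ (i, 0)\<bar> \<ge> ?b"
        using w b b0 i i' by (auto simp: g uvec_def)
      then have "(\<delta> / sqrt m * (1 / 2))\<^sup>2 \<le> (?w i - (?U * transpose_mat ?U) $$ (i, 0))\<^sup>2"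
        using b b0 by (intro abs_le_square_iff[THEN iffD1]) linarith
      then show ?thesis using w by (simp add: power_divide power_mult_distrib)
    qed simp
    have "\<delta>\<^sup>2 / (4 * m) * ?D \<le> (\<Sum>i\<in>S. (?w i - (?U * transpose_mat ?U) $$ (i, 0))\<^sup>2)"
      unfolding sum_distrib_left by (intro sum_mono wrong)
    also have "\<dots> \<le> (\<Sum>i<d1. (?w i - (?U * transpose_mat ?U) $$ (i, 0))\<^sup>2)"
      by (intro sum_mono2) (auto simp: S_def)
    also have "\<dots> \<le> (3 * spec_norm (Uh * R - ?U))\<^sup>2"
      using r by (intro gram_column_error_le[OF Uh L(1,2) R _ _ diag True]) auto
    finally have *: "\<delta>\<^sup>2 / (36 * m) * ?D \<le> (spec_norm (Uh * R - ?U))\<^sup>2"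
      by (simp add: power_mult_distrib)
    \<comment> \<open>36 is 9 times 4. Since ?D / m \<le> 1, its square root may be replaced by ?D /
      m itself, which gives a bound linear in the number of wrong signs, as Assouad's lemma
      needs.\<close>
    have "(\<delta> / (6 * m) * ?D)\<^sup>2 = \<delta>\<^sup>2 / (36 * m) * ?D * (?D / m)"
      by (simp add: power2_eq_square mult_ac)
    also have "\<dots> \<le> \<delta>\<^sup>2 / (36 * m) * ?D * 1"
      using D_le D_ge m' by (intro mult_left_mono) auto
    finally have "(\<delta> / (6 * m) * ?D)\<^sup>2 \<le> (spec_norm (Uh * R - ?U))\<^sup>2" using * by simp
    moreover have "spec_norm (Uh * R - ?U) \<ge> 0"
      using r L(1) by (intro spec_norm_nonneg[of _ d1 r]) auto
    ultimately show ?thesis by (rule power2_le_imp_le)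
  qed
  show ?thesis
    unfolding rot_loss_def
  proof (rule cInf_greatest)
    have "1\<^sub>m r \<in> orth_mats r" by (simp add: orth_mats_def)
    then show "{nm (Uh * R - ?U) |R. R \<in> orth_mats r} \<noteq> {}" by blast
    fix x assume "x \<in> {nm (Uh * R - ?U) |R. R \<in> orth_mats r}"
    then obtain R where R: "R \<in> orth_mats r" "x = nm (Uh * R - ?U)" by blast
    have "\<kappa> * (\<delta> / (6 * m) * ?D) \<le> \<kappa> * spec_norm (Uh * R - ?U)"
      using bound[OF R(1)] \<kappa> by (rule mult_left_mono)
    also have "\<dots> \<le> x" unfolding R(2) using L(1) by (intro nm) auto
    finally show "\<kappa> * (\<delta> / (6 * m) * ?D) \<le> x" .
  qed
qed

end

section \<open>Mixed likelihoods of the hypotheses and the risk bound for fixed separation\<close>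

context hypotheses
begin

sublocale masked_noise "idx d1 d2" \<sigma> p
  using \<sigma> p by unfold_locales (auto simp: idx_def)

lemma noise_mask_eq: "noise_mask d1 d2 \<sigma> p = NM"
  by (simp add: noise_mask_def entry_law_def)

text \<open>The rows in which u may be nonzero, within one column: exactly the entries that share
  the random sign of that column.\<close>

definition col_block :: "nat \<Rightarrow> (nat \<times> nat) set" where
  "col_block j = insert 0 S \<times> {j}"

definition amplitude :: "nat set \<Rightarrow> nat \<times> nat \<Rightarrow> real" where
  "amplitude \<theta> x = ss * uvec \<theta> (fst x) / sqrt n"

text \<open>Likelihood of \<theta> with the signs of v averaged out; these are independent across
  columns, so it is a product of one mixture per column.\<close>

definition lik :: "nat set \<Rightarrow> (nat \<times> nat \<Rightarrow> real \<times> bool) \<Rightarrow> real" where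
  "lik \<theta> \<omega> = (\<Prod>j\<in>J. mix_lr (col_block j) (amplitude \<theta>) \<omega>)"

lemma col_block_subset: "j \<in> J \<Longrightarrow> col_block j \<subseteq> idx d1 d2"
  using r by (auto simp: col_block_def idx_def J_def S_def)

lemma finite_col_block [simp]: "finite (col_block j)"
  by (simp add: col_block_def)

lemma disjoint_col_block: "disjoint_family_on col_block J"
  by (auto simp: disjoint_family_on_def col_block_def)

lemma lik_nonneg: "lik \<theta> \<omega> \<ge> 0"
  unfolding lik_def by (intro prod_nonneg) (simp add: less_imp_le[OF mix_lr_pos])

lemma lik_integrable: "integrable NM (lik \<theta>)" and lik_integral: "(\<integral>\<omega>. lik \<theta> \<omega> \<partial>NM) = 1"
  unfolding lik_def
  by (intro prod_mix_lr_integrable prod_mix_lr_integral finite_SJ col_block_subset disjoint_col_block; assumption)+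

text \<open>Moves the hypothesis from the signal into the noise, so that the change of measure
  applies with the same observation map for all hypotheses.\<close>

lemma observe_signal:
  "observe d1 d2 (signal \<theta> \<eta>) \<omega> = observe d1 d2 base
     (\<lambda>x\<in>idx d1 d2. entry_shift (ss * uvec \<theta> (fst x) * vvec \<eta> (snd x)) (\<omega> x))"
  unfolding observe_def by (auto simp: restrict_def entry_shift_def idx_def signal_entry)

lemma sum_lr_signal:
  "(\<Sum>\<eta>\<in>Pow J. lr (idx d1 d2) (\<lambda>x. ss * uvec \<theta> (fst x) * vvec \<eta> (snd x)) \<omega>) = 2 ^ n * lik \<theta> \<omega>"
proof -
  let ?K = "\<Union>j\<in>J. col_block j"
  have "lr (idx d1 d2) (\<lambda>x. ss * uvec \<theta> (fst x) * vvec \<eta> (snd x)) =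
      lr ?K (\<lambda>x. if x \<in> (\<Union>j\<in>\<eta>. col_block j) then amplitude \<theta> x else - amplitude \<theta> x)"
    if "\<eta> \<in> Pow J" for \<eta>
  proof -
    have "lr (idx d1 d2) (\<lambda>x. ss * uvec \<theta> (fst x) * vvec \<eta> (snd x)) =
       lr (idx d1 d2) (\<lambda>x. if x \<in> ?K then (if x \<in> (\<Union>j\<in>\<eta>. col_block j) then amplitude \<theta> x else - amplitude \<theta> x) else 0)"
      \<comment> \<open>Outside the blocks u or v vanishes, so the shift is 0 there and the ratio
        reduces to the blocks.\<close>
      using that by (intro lr_cong) (auto simp: col_block_def vvec_def amplitude_def uvec_def)
    also have "\<dots> = lr ?K (\<lambda>x. if x \<in> (\<Union>j\<in>\<eta>. col_block j) then amplitude \<theta> x else - amplitude \<theta> x)"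
      by (rule lr_extend) (use col_block_subset in auto)
    finally show ?thesis .
  qed
  then show ?thesis
    unfolding lik_def
    by (subst prod_mix_lr_eq_sum) (auto simp: disjoint_col_block intro!: sum.cong)
qed

lemma sum_amplitude_sq: "(\<Sum>x\<in>col_block j. (amplitude \<theta> x)\<^sup>2) = ss\<^sup>2 / n"
proof -
  have "(\<Sum>x\<in>col_block j. (amplitude \<theta> x)\<^sup>2) = (\<Sum>i\<in>insert 0 S. ss\<^sup>2 / n * (uvec \<theta> i)\<^sup>2)"
    unfolding col_block_def
    by (subst sum.cartesian_product') (simp add: amplitude_def power_divide power_mult_distrib)
  also have "\<dots> = ss\<^sup>2 / n" by (simp only: sum_distrib_left[symmetric] sum_uvec_sq mult_1_right)
  finally show ?thesis .
qed

lemma lik_affinity: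
  assumes budget: "\<delta>\<^sup>2 * (p * ss\<^sup>2 / (m * \<sigma>\<^sup>2)) * min 1 (p * ss\<^sup>2 / (n * \<sigma>\<^sup>2)) \<le> 1 / 4"
    and i: "i \<in> S"
  shows "(\<integral>\<omega>. sqrt (lik \<theta> \<omega> * lik (flip i \<theta>) \<omega>) \<partial>NM) \<ge> 3 / 4"
proof -
  \<comment> \<open>Loss of affinity per column: the information in the rest of the column times
    that in the flipped entry. Multiplied by the n columns it is the left side of
    \<open>budget\<close>.\<close>
  define h where "h = min 1 (p * ss\<^sup>2 / (n * \<sigma>\<^sup>2)) * (p * (ss\<^sup>2 * \<delta>\<^sup>2 / (n * m)) / \<sigma>\<^sup>2)"
  have n1: "real n \<ge> 1" using n by linarith
  have nh: "real n * h \<le> 1 / 4"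
    using budget n1 by (simp add: h_def field_simps)
  have h0: "h \<ge> 0" unfolding h_def using p by (intro mult_nonneg_nonneg) auto
  have h1: "h \<le> 1" using nh n1 h0 mult_right_mono[of 1 "real n" h] by linarith
  have i0: "i \<noteq> 0" using i zero_notin_S by metis
  have "(\<integral>\<omega>. sqrt (lik \<theta> \<omega> * lik (flip i \<theta>) \<omega>) \<partial>NM) \<ge> 1 - real (card J) * h"
    unfolding lik_def
  proof (rule prod_mix_lr_affinity[OF finite_SJ(2) col_block_subset disjoint_col_block _ h0 h1])
    fix j assume j: "j \<in> J"
    let ?K = "col_block j" and ?a = "amplitude \<theta>" and ?x = "(i, j)"
    have x: "?x \<in> ?K" using i by (simp add: col_block_def)
    have sub: "?K - {?x} \<subseteq> idx d1 d2" "{?x} \<subseteq> idx d1 d2" using col_block_subset[OF j] x by auto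
    have flip: "mix_lr ?K (amplitude (flip i \<theta>)) = mix_lr ?K (?a(?x := - ?a ?x))"
      using i i0 by (intro mix_lr_cong) (auto simp: col_block_def amplitude_def uvec_def mem_flip_iff)
    \<comment> \<open>Removing the flipped entry only lowers the total squared amplitude of the
      column.\<close>
    have "(\<Sum>y\<in>?K - {?x}. (?a y)\<^sup>2) \<le> ss\<^sup>2 / n"
      unfolding sum_amplitude_sq[of \<theta> j, symmetric] by (intro sum_mono2) auto
    then have "p * (\<Sum>y\<in>?K - {?x}. (?a y)\<^sup>2) / \<sigma>\<^sup>2 \<le> p * (ss\<^sup>2 / n) / \<sigma>\<^sup>2"
      using p \<sigma> by (intro divide_right_mono mult_left_mono) auto
    then have rest: "(\<integral>\<omega>. sign_chi (?K - {?x}) ?a \<omega> \<partial>NM) \<le> min 1 (p * ss\<^sup>2 / (n * \<sigma>\<^sup>2))"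
      using sign_chi_integral_le[OF sub(1), of ?a] sign_chi_integral_le_1[OF sub(1), of ?a] by simp
    have "(?a ?x)\<^sup>2 = ss\<^sup>2 * \<delta>\<^sup>2 / (n * m)"
      using i i0 by (simp add: amplitude_def power_divide power_mult_distrib uvec_sq)
    then have one: "(\<integral>\<omega>. sign_chi {?x} ?a \<omega> \<partial>NM) \<le> p * (ss\<^sup>2 * \<delta>\<^sup>2 / (n * m)) / \<sigma>\<^sup>2"
      using sign_chi_integral_le[OF sub(2), of ?a] by simp
    have "(\<integral>\<omega>. sign_chi (?K - {?x}) ?a \<omega> \<partial>NM) * (\<integral>\<omega>. sign_chi {?x} ?a \<omega> \<partial>NM) \<le> h"
      unfolding h_def using rest one p
      by (intro mult_mono) (auto intro!: Bochner_Integration.integral_nonneg sign_chi_nonneg)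
    then show "(\<integral>\<omega>. sqrt (mix_lr ?K ?a \<omega> * mix_lr ?K (amplitude (flip i \<theta>)) \<omega>) \<partial>NM) \<ge> 1 - h"
      unfolding flip using mix_lr_affinity[OF col_block_subset[OF j] x, of ?a] by linarith
  qed
  then show ?thesis using nh by linarith
qed

lemma observe_measurable: "observe d1 d2 A \<in> NM \<rightarrow>\<^sub>M obs_space d1 d2"
  unfolding observe_def obs_space_def
proof (rule measurable_restrict)
  fix x assume x: "x \<in> idx d1 d2"
  have [measurable]: "(\<lambda>\<omega>. \<omega> x) \<in> NM \<rightarrow>\<^sub>M (borel \<Otimes>\<^sub>M count_space UNIV)"
    using measurable_component_singleton[OF x, of "\<lambda>_. entry_law \<sigma> p"]
    by (simp cong: measurable_cong_sets add: measurable_cong_sets[OF refl sets_entry_law])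
  show "(\<lambda>\<omega>. (if snd (\<omega> x) then A $$ x + fst (\<omega> x) else 0, snd (\<omega> x))) \<in> NM \<rightarrow>\<^sub>M (borel \<Otimes>\<^sub>M count_space UNIV)"
    by measurable
qed

text \<open>The supremum is at least the average over all 2^m * 2^n signals. Averaging over v first
  yields \<open>lik\<close>, and Assouad's lemma is then applied over \<theta> alone.\<close>

lemma risk_ge:
  assumes budget: "\<delta>\<^sup>2 * (p * ss\<^sup>2 / (m * \<sigma>\<^sup>2)) * min 1 (p * ss\<^sup>2 / (n * \<sigma>\<^sup>2)) \<le> 1 / 4"
    and nm: "\<And>E. E \<in> carrier_mat d1 r \<Longrightarrow> nm E \<ge> \<kappa> * spec_norm E" and \<kappa>: "\<kappa> \<ge> 0"
  shows "minimax_risk nm d1 d2 r \<sigma> p ss \<ge> ennreal (\<kappa> * \<delta> / 48)"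
  unfolding minimax_risk_def noise_mask_eq
proof (rule INF_greatest)
  fix Uh assume Uh: "Uh \<in> estimators d1 d2 r"
  let ?risk = "SUP A\<in>Mstar d1 d2 r ss. \<integral>\<^sup>+\<omega>. ennreal (rot_loss nm r (Uh (observe d1 d2 A \<omega>)) (left_sv d1 d2 r A)) \<partial>NM"
  define dec where "dec i y \<longleftrightarrow> (Uh y * transpose_mat (Uh y)) $$ (i, 0) > 0" for i y
  define H where "H \<theta> y = ennreal (\<Sum>i\<in>S. of_bool (dec i y \<noteq> (i \<in> \<theta>)))" for \<theta> y
  define c where "c = \<kappa> * (\<delta> / (6 * m))"
  have c: "c \<ge> 0" unfolding c_def using \<kappa> \<delta> by simp
  have Uh_carrier: "Uh y \<in> carrier_mat d1 r" for y using Uh by (simp add: estimators_def)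
  have dec_meas: "Measurable.pred (obs_space d1 d2) (dec i)" if i: "i \<in> S" for i
  proof -
    have i': "i < d1" using i by (auto simp: S_def)
    have "dec i = (\<lambda>y. (\<Sum>k<r. Uh y $$ (i, k) * Uh y $$ (0, k)) > 0)"
      unfolding dec_def using i' r carrier_matD[OF Uh_carrier]
      by (auto simp: fun_eq_iff scalar_prod_def lessThan_atLeast0)
    moreover have "(\<lambda>y. \<Sum>k<r. Uh y $$ (i, k) * Uh y $$ (0, k)) \<in> borel_measurable (obs_space d1 d2)"
      using Uh i' r by (intro borel_measurable_sum borel_measurable_times) (auto simp: estimators_def)
    ultimately show ?thesis by simp
  qed
  note [measurable] = dec_meas observe_measurable[of base]
  have H_meas [measurable]: "H \<theta> \<in> borel_measurable (obs_space d1 d2)" for \<theta>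
    unfolding H_def by measurable
  have lr_meas [measurable]: "lr (idx d1 d2) a \<in> borel_measurable NM" for a
    by (rule lr_measurable) simp
  have point: "ennreal c * (\<integral>\<^sup>+\<omega>. ennreal (lr (idx d1 d2) (\<lambda>x. ss * uvec \<theta> (fst x) * vvec \<eta> (snd x)) \<omega>) *
      H \<theta> (observe d1 d2 base \<omega>) \<partial>NM) \<le> ?risk" for \<theta> \<eta>
  proof -
    let ?A = "signal \<theta> \<eta>" and ?T = "\<lambda>\<omega>. \<lambda>x\<in>idx d1 d2. entry_shift (ss * uvec \<theta> (fst x) * vvec \<eta> (snd x)) (\<omega> x)"
    have "(\<integral>\<^sup>+\<omega>. ennreal (lr (idx d1 d2) (\<lambda>x. ss * uvec \<theta> (fst x) * vvec \<eta> (snd x)) \<omega>) *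
        H \<theta> (observe d1 d2 base \<omega>) \<partial>NM) = (\<integral>\<^sup>+\<omega>. H \<theta> (observe d1 d2 base (?T \<omega>)) \<partial>NM)"
      by (rule nn_integral_entry_shift[symmetric]) measurable
    also have "\<dots> = (\<integral>\<^sup>+\<omega>. H \<theta> (observe d1 d2 ?A \<omega>) \<partial>NM)"
      by (simp add: observe_signal)
    also have "ennreal c * \<dots> = (\<integral>\<^sup>+\<omega>. ennreal c * H \<theta> (observe d1 d2 ?A \<omega>) \<partial>NM)"
      by (rule nn_integral_cmult[symmetric], rule measurable_compose[OF observe_measurable H_meas])
    also have "\<dots> \<le> (\<integral>\<^sup>+\<omega>. ennreal (rot_loss nm r (Uh (observe d1 d2 ?A \<omega>)) (left_sv d1 d2 r ?A)) \<partial>NM)"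
    proof (rule nn_integral_mono)
      fix \<omega>
      let ?y = "observe d1 d2 ?A \<omega>"
      have "ennreal c * H \<theta> ?y = ennreal (c * (\<Sum>i\<in>S. of_bool (dec i ?y \<noteq> (i \<in> \<theta>))))"
        unfolding H_def using c by (intro ennreal_mult[symmetric] sum_nonneg) auto
      also have "\<dots> \<le> ennreal (rot_loss nm r (Uh ?y) (left_sv d1 d2 r ?A))"
        using rot_loss_ge_hamming[OF Uh_carrier nm \<kappa>, of ?y \<theta> \<eta>]
        by (intro ennreal_leI) (simp add: c_def dec_def mult.assoc)
      finally show "ennreal c * H \<theta> ?y \<le> ennreal (rot_loss nm r (Uh ?y) (left_sv d1 d2 r ?A))" .
    qed
    also have "\<dots> \<le> ?risk"
      by (rule SUP_upper) (rule compact_svd_in_Mstar[OF compact_svd_signal r(1) ss])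
    finally show ?thesis .
  qed
  \<comment> \<open>The Hamming loss \<open>H\<close> depends on \<theta> but not on the signs of v,
    so the sum over \<eta> can be taken inside on the likelihoods only.\<close>
  have mixture: "(\<Sum>\<eta>\<in>Pow J. \<integral>\<^sup>+\<omega>. ennreal (lr (idx d1 d2) (\<lambda>x. ss * uvec \<theta> (fst x) * vvec \<eta> (snd x)) \<omega>) *
      H \<theta> (observe d1 d2 base \<omega>) \<partial>NM) = ennreal (2 ^ n) * (\<integral>\<^sup>+\<omega>. ennreal (lik \<theta> \<omega>) * H \<theta> (observe d1 d2 base \<omega>) \<partial>NM)" for \<theta>
  proof -
    have [measurable]: "lik \<theta> \<in> borel_measurable NM" using lik_integrable by blast
    have "(\<Sum>\<eta>\<in>Pow J. \<integral>\<^sup>+\<omega>. ennreal (lr (idx d1 d2) (\<lambda>x. ss * uvec \<theta> (fst x) * vvec \<eta> (snd x)) \<omega>) *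
      H \<theta> (observe d1 d2 base \<omega>) \<partial>NM) =
      (\<integral>\<^sup>+\<omega>. (\<Sum>\<eta>\<in>Pow J. ennreal (lr (idx d1 d2) (\<lambda>x. ss * uvec \<theta> (fst x) * vvec \<eta> (snd x)) \<omega>) *
      H \<theta> (observe d1 d2 base \<omega>)) \<partial>NM)"
      by (rule nn_integral_sum[symmetric]) measurable
    also have "\<dots> = (\<integral>\<^sup>+\<omega>. ennreal (2 ^ n) * (ennreal (lik \<theta> \<omega>) * H \<theta> (observe d1 d2 base \<omega>)) \<partial>NM)"
    proof (rule nn_integral_cong)
      fix \<omega>
      have "(\<Sum>\<eta>\<in>Pow J. ennreal (lr (idx d1 d2) (\<lambda>x. ss * uvec \<theta> (fst x) * vvec \<eta> (snd x)) \<omega>)) = ennreal (2 ^ n * lik \<theta> \<omega>)"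
        unfolding sum_lr_signal[symmetric] by (rule sum_ennreal) (simp add: less_imp_le[OF lr_pos])
      also have "\<dots> = ennreal (2 ^ n) * ennreal (lik \<theta> \<omega>)" by (rule ennreal_mult) (auto simp: lik_nonneg)
      finally show "(\<Sum>\<eta>\<in>Pow J. ennreal (lr (idx d1 d2) (\<lambda>x. ss * uvec \<theta> (fst x) * vvec \<eta> (snd x)) \<omega>) *
          H \<theta> (observe d1 d2 base \<omega>)) = ennreal (2 ^ n) * (ennreal (lik \<theta> \<omega>) * H \<theta> (observe d1 d2 base \<omega>))"
        by (simp only: sum_distrib_right[symmetric] mult.assoc)
    qed
    also have "\<dots> = ennreal (2 ^ n) * (\<integral>\<^sup>+\<omega>. ennreal (lik \<theta> \<omega>) * H \<theta> (observe d1 d2 base \<omega>) \<partial>NM)"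
      by (rule nn_integral_cmult) measurable
    finally show ?thesis .
  qed
  have "ennreal (2 ^ m * real m / 8) \<le>
      (\<Sum>\<theta>\<in>Pow S. \<integral>\<^sup>+\<omega>. ennreal (lik \<theta> \<omega>) * H \<theta> (observe d1 d2 base \<omega>) \<partial>NM)"
    unfolding H_def
    by (rule assouad) (use lik_affinity[OF budget] in \<open>auto simp: lik_nonneg lik_integrable lik_integral\<close>)
  then have "ennreal c * (ennreal (2 ^ n) * ennreal (2 ^ m * real m / 8)) \<le>
      ennreal c * (ennreal (2 ^ n) * (\<Sum>\<theta>\<in>Pow S. \<integral>\<^sup>+\<omega>. ennreal (lik \<theta> \<omega>) * H \<theta> (observe d1 d2 base \<omega>) \<partial>NM))"
    by (intro mult_left_mono) auto
  also have "\<dots> = (\<Sum>\<theta>\<in>Pow S. \<Sum>\<eta>\<in>Pow J. ennreal c * (\<integral>\<^sup>+\<omega>. ennreal (lr (idx d1 d2)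
      (\<lambda>x. ss * uvec \<theta> (fst x) * vvec \<eta> (snd x)) \<omega>) * H \<theta> (observe d1 d2 base \<omega>) \<partial>NM))"
    by (simp only: sum_distrib_left mixture[symmetric])
  also have "\<dots> \<le> (\<Sum>\<theta>\<in>Pow S. \<Sum>\<eta>\<in>Pow J. ?risk)"
    by (intro sum_mono point)
  also have "\<dots> = ennreal (2 ^ m * 2 ^ n) * ?risk"
    by (simp add: card_Pow mult.assoc ennreal_mult ennreal_power[symmetric])
  finally have "ennreal (2 ^ m * 2 ^ n) * ennreal (\<kappa> * \<delta> / 48) \<le> ennreal (2 ^ m * 2 ^ n) * ?risk"
  proof (rule order_trans[rotated])
    \<comment> \<open>48 = 6 * 8, from the decoding bound and from Assouad's lemma; the factor m
      cancels.\<close>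
    have "2 ^ m * 2 ^ n * (\<kappa> * \<delta> / 48) = c * (2 ^ n * (2 ^ m * real m / 8))"
      using m(2) by (cases "S = {}") (simp_all add: c_def)
    then show "ennreal (2 ^ m * 2 ^ n) * ennreal (\<kappa> * \<delta> / 48) \<le> ennreal c * (ennreal (2 ^ n) * ennreal (2 ^ m * real m / 8))"
      using c \<kappa> \<delta> by (simp flip: ennreal_mult)
  qed
  then show "ennreal (\<kappa> * \<delta> / 48) \<le> ?risk"
    by (subst (asm) ennreal_mult_le_mult_iff) auto
qed

end

section \<open>From the admissible separation to the two-term rate\<close>

lemma rate_comparison:
  fixes d1 d2 r :: nat and q :: real
  assumes r: "1 \<le> r" "2 * r \<le> d1" "r \<le> d2" and q: "q \<ge> 0"
  shows "min (q * sqrt (real d1 * real d2) + sqrt (q * real d1)) 1 \<le>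
    4 * max (sqrt (q * real (d1 - r))) (q * sqrt (real (d1 - r) * real (d2 - r + 1)))"
proof -
  let ?m = "real (d1 - r)" and ?n = "real (d2 - r + 1)"
  let ?M = "max (sqrt (q * ?m)) (q * sqrt (?m * ?n))"
  define a where "a = sqrt (q * real d1)"
  have a: "a \<ge> 0" "a\<^sup>2 = q * real d1" using q by (auto simp: a_def)
  \<comment> \<open>The weaker bound with 4 is taken because its square root is 2.\<close>
  have m: "real d1 \<le> 4 * ?m" "real d1 \<le> 2 * ?m" using r by linarith+
  have "a \<le> sqrt (4 * (q * ?m))"
    unfolding a_def using mult_left_mono[OF m(1) q] by (simp add: algebra_simps)
  then have aM: "a \<le> 2 * ?M" by (simp add: real_sqrt_mult)
  have sqrt4: "sqrt ((2 * x) * (2 * y)) = 2 * sqrt (x * y)" for x y :: real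
    using real_sqrt_mult[of 4 "x * y"] by (simp add: mult_ac)
  show ?thesis
  proof (cases "real d2 \<le> 2 * ?n")
    case True
    have "sqrt (real d1 * real d2) \<le> sqrt ((2 * ?m) * (2 * ?n))"
      using m(2) True by (intro real_sqrt_le_mono mult_mono) auto
    also have "\<dots> = 2 * sqrt (?m * ?n)"
      by (rule sqrt4)
    finally have "q * sqrt (real d1 * real d2) \<le> q * (2 * sqrt (?m * ?n))"
      using q by (rule mult_left_mono)
    then have "q * sqrt (real d1 * real d2) \<le> 2 * ?M" by simp
    then show ?thesis using aM unfolding a_def by linarith
  next
    \<comment> \<open>Here n is less than half of d2, which forces d2 < 2 r \<le> d1. The quadratic
      term is then at most q d1, the square of the linear term a.\<close>
    case False
    then have "2 * (d2 - r + 1) < d2" by linarith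
    then have "d2 \<le> d1" using r by presburger
    then have "sqrt (real d1 * real d2) \<le> sqrt (real d1 * real d1)"
      by (intro real_sqrt_le_mono mult_left_mono) auto
    then have "q * sqrt (real d1 * real d2) \<le> q * real d1"
      using q by (intro mult_left_mono) auto
    then have b: "q * sqrt (real d1 * real d2) \<le> a * a" using a by (simp add: power2_eq_square)
    show ?thesis
    \<comment> \<open>If a \<le> 1 then its square is at most a; otherwise the minimum is at most 1,
      which a already exceeds.\<close>
    proof (cases "a \<le> 1")
      case True
      then have "a * a \<le> a" using a by (simp add: mult_left_le)
      then show ?thesis using b aM unfolding a_def by linarith
    next
      case False
      then show ?thesis using aM by linarith
    qed
  qed
qed

theorem theorem2:
  "\<exists>c_lb>0. \<forall>(d1::nat) (d2::nat) (r::nat) (\<sigma>::real) (ss::real) (p::real).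
     1 \<le> r \<and> real r \<le> real d1 / 2 \<and> r \<le> d2 \<and> 0 < \<sigma> \<and> 0 < ss \<and> 0 < p \<and> p \<le> 1 \<longrightarrow>
     minimax_risk spec_norm d1 d2 r \<sigma> p ss \<ge>
       ennreal (c_lb * min ((\<sigma>^2 / ss^2) * (sqrt (real d1 * real d2) / p) + (\<sigma> / ss) * sqrt (real d1 / p)) 1)
     \<and>
     minimax_risk norm_2inf d1 d2 r \<sigma> p ss \<ge>
       ennreal (c_lb / sqrt (real d1) * min ((\<sigma>^2 / ss^2) * (sqrt (real d1 * real d2) / p) + (\<sigma> / ss) * sqrt (real d1 / p)) 1)"
proof (intro exI[of _ "1 / 384 :: real"] conjI allI impI)
  fix d1 d2 r :: nat and \<sigma> ss p :: real
  assume "1 \<le> r \<and> real r \<le> real d1 / 2 \<and> r \<le> d2 \<and> 0 < \<sigma> \<and> 0 < ss \<and> 0 < p \<and> p \<le> 1"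
  then have dims: "1 \<le> r" "2 * r \<le> d1" "r \<le> d2" "r < d1" and \<sigma>: "0 < \<sigma>" and ss: "0 < ss" and p: "0 < p" "p \<le> 1"
    by linarith+
  define q where "q = \<sigma>\<^sup>2 / (p * ss\<^sup>2)"
  let ?m = "real (d1 - r)" and ?n = "real (d2 - r + 1)"
  let ?M = "max (sqrt (q * ?m)) (q * sqrt (?m * ?n))"
  let ?t = "(\<sigma>^2 / ss^2) * (sqrt (real d1 * real d2) / p) + (\<sigma> / ss) * sqrt (real d1 / p)"
  \<comment> \<open>The half serves twice: it gives \<delta> \<le> 1/2, and it makes \<delta>^2 at
    most a quarter of \<open>?M\<close> squared, which is the 1/4 of the budget.\<close>
  define \<delta> where "\<delta> = min 1 ?M / 2"
  have q: "q > 0" unfolding q_def using \<sigma> ss p by simp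
  have mn: "?m > 0" "?n > 0" using dims by auto
  have M: "?M > 0" using q mn by (simp add: less_max_iff_disj)
  have \<delta>_le: "0 < \<delta>" "\<delta> \<le> 1 / 2" "\<delta> \<le> ?M / 2" using M unfolding \<delta>_def by auto
  interpret hypotheses d1 d2 r \<sigma> ss p \<delta>
    using dims \<sigma> ss p \<delta>_le by unfold_locales auto
  have inv: "p * ss\<^sup>2 / (real k * \<sigma>\<^sup>2) = 1 / (q * real k)" for k
    unfolding q_def by simp
  have budget: "\<delta>\<^sup>2 * (p * ss\<^sup>2 / (m * \<sigma>\<^sup>2)) * min 1 (p * ss\<^sup>2 / (n * \<sigma>\<^sup>2)) \<le> 1 / 4"
  proof -
    have "\<delta>\<^sup>2 \<le> (?M / 2)\<^sup>2" by (rule power_mono[OF \<delta>_le(3)]) (use \<delta>_le(1) in simp)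
    then have d: "\<delta>\<^sup>2 \<le> ?M\<^sup>2 / 4" by (simp add: power_divide)
    have two: "a * (1 / (q * x)) * (1 / (q * y)) \<le> 1 / 4"
      if "a \<le> q\<^sup>2 * (x * y) / 4" "x > 0" "y > 0" for a x y :: real
      using q that by (simp add: field_simps power2_eq_square)
    have "\<delta>\<^sup>2 * (1 / (q * ?m)) * min 1 (1 / (q * ?n)) \<le> 1 / 4"
    \<comment> \<open>Whichever scale attains the maximum selects the entry of the minimum that is
      used: 1 for the linear scale, 1 / (q n) for the quadratic one.\<close>
    proof (cases "?M = sqrt (q * ?m)")
      case True
      then have "\<delta>\<^sup>2 \<le> q * ?m / 4" using d q by simp
      then have "\<delta>\<^sup>2 * (1 / (q * ?m)) \<le> 1 / 4" using q mn by (simp add: field_simps)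
      moreover have "\<delta>\<^sup>2 * (1 / (q * ?m)) * min 1 (1 / (q * ?n)) \<le> \<delta>\<^sup>2 * (1 / (q * ?m)) * 1"
        using q mn by (intro mult_left_mono) auto
      ultimately show ?thesis unfolding mult_1_right by (rule order_trans[rotated])
    next
      case False
      then have "?M = q * sqrt (?m * ?n)" by (simp add: max_def split: if_splits)
      then have "\<delta>\<^sup>2 \<le> q\<^sup>2 * (?m * ?n) / 4" using d mn by (simp add: power_mult_distrib)
      then have "\<delta>\<^sup>2 * (1 / (q * ?m)) * (1 / (q * ?n)) \<le> 1 / 4"
        by (rule two[OF _ mn])
      moreover have "\<delta>\<^sup>2 * (1 / (q * ?m)) * min 1 (1 / (q * ?n)) \<le> \<delta>\<^sup>2 * (1 / (q * ?m)) * (1 / (q * ?n))"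
        using q mn by (intro mult_left_mono) auto
      ultimately show ?thesis by (rule order_trans[rotated])
    qed
    then show ?thesis using m n by (simp only: inv)
  qed
  \<comment> \<open>384 = 4 * 2 * 48: the rate comparison, the half in \<delta>, and the risk
    bound.\<close>
  have scale: "1 / 384 * min t 1 \<le> min 1 x / 2 / 48" if "min t 1 \<le> 4 * x" for t x :: real
    using that by linarith
  have "sqrt (q * real d1) = \<sigma> / ss * sqrt (real d1 / p)"
    using \<sigma> ss p by (simp add: q_def real_sqrt_mult real_sqrt_divide)
  moreover have "q * sqrt (real d1 * real d2) = (\<sigma>^2 / ss^2) * (sqrt (real d1 * real d2) / p)"
    by (simp add: q_def)
  ultimately have "min ?t 1 \<le> 4 * ?M"
    using rate_comparison[OF dims(1-3), of q] q by simp
  then have rate: "1 / 384 * min ?t 1 \<le> \<delta> / 48" unfolding \<delta>_def by (rule scale)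
  have "ennreal (1 / 384 * min ?t 1) \<le> ennreal (1 * \<delta> / 48)"
    using rate by (intro ennreal_leI) simp
  also have "\<dots> \<le> minimax_risk spec_norm d1 d2 r \<sigma> p ss"
    by (rule risk_ge[OF budget]) auto
  finally show "ennreal (1 / 384 * min ?t 1) \<le> minimax_risk spec_norm d1 d2 r \<sigma> p ss" .
  have sd: "sqrt (real d1) > 0" using dims by simp
  have "ennreal (1 / 384 / sqrt (real d1) * min ?t 1) \<le> ennreal (1 / sqrt (real d1) * \<delta> / 48)"
    using divide_right_mono[OF rate less_imp_le[OF sd]] by (intro ennreal_leI) (simp add: mult_ac)
  also have "\<dots> \<le> minimax_risk norm_2inf d1 d2 r \<sigma> p ss"
  proof (rule risk_ge[OF budget])
    fix E :: "real mat" assume "E \<in> carrier_mat d1 r"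
    then have "spec_norm E \<le> sqrt (real d1) * norm_2inf E"
      using dims by (intro spec_norm_le_norm_2inf) auto
    then show "1 / sqrt (real d1) * spec_norm E \<le> norm_2inf E"
      using sd by (simp add: field_simps)
  qed (use sd in simp)
  finally show "ennreal (1 / 384 / sqrt (real d1) * min ?t 1) \<le> minimax_risk norm_2inf d1 d2 r \<sigma> p ss" .
qed simp

end
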